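(* Let $\mathcal{H}=\mathcal{H}_1\oplus\mathcal{H}_2$ be a nontrivial orthogonal decomposition of a complex Hilbert space and suppose that $T=\begin{bmatrix} V & E\\ 0 & Q\end{bmatrix}\in\mathcal{Q}_{\mathcal{H}_1,\mathcal{H}_2}$. Then $$\|T\|=\max\{1,r(|Q|,|E|)\}.$$
   Context: $B(\mathcal{H},\mathcal{K})$ denotes the bounded linear operators between complex Hilbert spaces, $B(\mathcal{H})=B(\mathcal{H},\mathcal{H})$; $|T|=(T^*T)^{1/2}$. Class $\mathcal{Q}$: an orthogonal decomposition $\mathcal{H}=\mathcal{H}_1\oplus\mathcal{H}_2$ is nontrivial if $\mathcal{H}_1\neq\{0\}$ and $\mathcal{H}_2\neq\{0\}$. For such a decomposition, $T=\begin{bmatrix} V & E\\ 0 & Q\end{bmatrix}\in\mathcal{Q}_{\mathcal{H}_1,\mathcal{H}_2}$ means that $T\in B(\mathcal{H})$ has this block form with $V\in B(\mathcal{H}_1)$, $E\in B(\mathcal{H}_2,\mathcal{H}_1)$, $Q\in B(\mathcal{H}_2)$ satisfying $V^*V=I$, $V^*E=0$, $QE^*E=E^*EQ$, and $Q$ is quasinormal, i.e. $QQ^*Q=Q^*QQ$. Then $|Q|$ and $|E|$ are commuting positive operators. For commuting $T_1,T_2\in B(\mathcal{H})$, $\sigma(T_1,T_2)$ is the Taylor spectrum of $(T_1,T_2)$, and the geometric spectral radius is $r(T_1,T_2)=\max\{(|z_1|^2+|z_2|^2)^{1/2}:(z_1,z_2)\in\sigma(T_1,T_2)\}$. *)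

theory Defs
  imports "HOL-Analysis.Analysis"
begin

text \<open>The inner product is linear in its first argument. The last axiom makes it positive
  definite and says that it induces the norm; completeness is part of \<^class>\<open>banach\<close>.\<close>

class complex_hilbert_space = banach +
  fixes scaleC :: "complex \<Rightarrow> 'a \<Rightarrow> 'a" (infixr "*\<^sub>C" 75)
    and cinner :: "'a \<Rightarrow> 'a \<Rightarrow> complex"
  assumes scaleC_add_right: "c *\<^sub>C (x + y) = c *\<^sub>C x + c *\<^sub>C y"
    and scaleC_add_left: "(c + d) *\<^sub>C x = c *\<^sub>C x + d *\<^sub>C x"
    and scaleC_scaleC: "c *\<^sub>C d *\<^sub>C x = (c * d) *\<^sub>C x"
    and scaleC_of_real: "complex_of_real r *\<^sub>C x = r *\<^sub>R x"
    and cinner_commute: "cinner x y = cnj (cinner y x)"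
    and cinner_add_left: "cinner (x + y) z = cinner x z + cinner y z"
    and cinner_scaleC_left: "cinner (c *\<^sub>C x) y = c * cinner x y"
    and cinner_self: "cinner x x = complex_of_real ((norm x)\<^sup>2)"

instantiation complex :: complex_hilbert_space
begin

definition scaleC_complex :: "complex \<Rightarrow> complex \<Rightarrow> complex"
  where "scaleC_complex c x = c * x"

definition cinner_complex :: "complex \<Rightarrow> complex \<Rightarrow> complex"
  where "cinner_complex x y = x * cnj y"

instance
  by standard
    (simp_all add: scaleC_complex_def cinner_complex_def algebra_simps scaleR_conv_of_real
      flip: complex_norm_square)

end

text \<open>The Hilbert direct sum \<open>H\<^sub>1 \<oplus> H\<^sub>2\<close> is the product type, whose library norm is
  \<open>sqrt ((norm x)\<^sup>2 + (norm y)\<^sup>2)\<close>.\<close>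

instantiation prod :: (complex_hilbert_space, complex_hilbert_space) complex_hilbert_space
begin

definition scaleC_prod :: "complex \<Rightarrow> 'a \<times> 'b \<Rightarrow> 'a \<times> 'b"
  where "scaleC_prod c p = (c *\<^sub>C fst p, c *\<^sub>C snd p)"

definition cinner_prod :: "'a \<times> 'b \<Rightarrow> 'a \<times> 'b \<Rightarrow> complex"
  where "cinner_prod p q = cinner (fst p) (fst q) + cinner (snd p) (snd q)"

instance
proof
  fix p q r :: "'a \<times> 'b" and c d :: complex and s :: real
  show "c *\<^sub>C (p + q) = c *\<^sub>C p + c *\<^sub>C q"
    by (simp add: scaleC_prod_def scaleC_add_right)
  show "(c + d) *\<^sub>C p = c *\<^sub>C p + d *\<^sub>C p"
    by (simp add: scaleC_prod_def scaleC_add_left)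
  show "c *\<^sub>C d *\<^sub>C p = (c * d) *\<^sub>C p"
    by (simp add: scaleC_prod_def scaleC_scaleC)
  show "complex_of_real s *\<^sub>C p = s *\<^sub>R p"
    by (simp add: scaleC_prod_def scaleC_of_real scaleR_prod_def)
  show "cinner p q = cnj (cinner q p)"
    using cinner_commute[of "fst p" "fst q"] cinner_commute[of "snd p" "snd q"]
    by (simp add: cinner_prod_def)
  show "cinner (p + q) r = cinner p r + cinner q r"
    by (simp add: cinner_prod_def cinner_add_left)
  show "cinner (c *\<^sub>C p) q = c * cinner p q"
    by (simp add: cinner_prod_def scaleC_prod_def cinner_scaleC_left distrib_left)
  show "cinner p p = complex_of_real ((norm p)\<^sup>2)"
    by (simp add: cinner_prod_def cinner_self norm_prod_def)
qed

end

definition bounded_clinear ::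
    "('a::complex_hilbert_space \<Rightarrow> 'b::complex_hilbert_space) \<Rightarrow> bool"
  where "bounded_clinear A \<longleftrightarrow> bounded_linear A \<and> (\<forall>c x. A (c *\<^sub>C x) = c *\<^sub>C A x)"

definition cadjoint ::
    "('a::complex_hilbert_space \<Rightarrow> 'b::complex_hilbert_space) \<Rightarrow> 'b \<Rightarrow> 'a"
  where "cadjoint A = (THE B. \<forall>x y. cinner (A x) y = cinner x (B y))"

definition positive_op :: "('a::complex_hilbert_space \<Rightarrow> 'a) \<Rightarrow> bool"
  where "positive_op P \<longleftrightarrow> bounded_clinear P \<and> (\<forall>x. cinner (P x) x \<in> \<real>\<^sub>\<ge>\<^sub>0)"

definition sqrt_op :: "('a::complex_hilbert_space \<Rightarrow> 'a) \<Rightarrow> 'a \<Rightarrow> 'a"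
  where "sqrt_op A = (THE P. positive_op P \<and> P \<circ> P = A)"

definition abs_op :: "('a::complex_hilbert_space \<Rightarrow> 'b::complex_hilbert_space) \<Rightarrow> 'a \<Rightarrow> 'a"
  where "abs_op A = sqrt_op (cadjoint A \<circ> A)"

definition quasinormal :: "('a::complex_hilbert_space \<Rightarrow> 'a) \<Rightarrow> bool"
  where "quasinormal Q \<longleftrightarrow> Q \<circ> cadjoint Q \<circ> Q = cadjoint Q \<circ> Q \<circ> Q"

text \<open>For commuting \<open>A\<close> and \<open>B\<close>, the Koszul complex is
  \<open>0 \<rightarrow> H \<rightarrow> H \<oplus> H \<rightarrow> H \<rightarrow> 0\<close> with the following two boundary maps. The
  pair \<open>(z, w)\<close> belongs to the Taylor spectrum of \<open>(A, B)\<close> iff the Koszul complex of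
  \<open>(A - z, B - w)\<close> fails to be exact at one of its three places.\<close>

definition koszul0 :: "('a::complex_hilbert_space \<Rightarrow> 'a) \<Rightarrow> ('a \<Rightarrow> 'a) \<Rightarrow> 'a \<Rightarrow> 'a \<times> 'a"
  where "koszul0 A B x = (A x, B x)"

definition koszul1 :: "('a::complex_hilbert_space \<Rightarrow> 'a) \<Rightarrow> ('a \<Rightarrow> 'a) \<Rightarrow> 'a \<times> 'a \<Rightarrow> 'a"
  where "koszul1 A B p = A (snd p) - B (fst p)"

definition koszul_exact :: "('a::complex_hilbert_space \<Rightarrow> 'a) \<Rightarrow> ('a \<Rightarrow> 'a) \<Rightarrow> bool"
  where "koszul_exact A B \<longleftrightarrow>
    {x. koszul0 A B x = 0} = {0} \<and>
    range (koszul0 A B) = {p. koszul1 A B p = 0} \<and>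
    range (koszul1 A B) = UNIV"

definition taylor_spectrum ::
    "('a::complex_hilbert_space \<Rightarrow> 'a) \<Rightarrow> ('a \<Rightarrow> 'a) \<Rightarrow> (complex \<times> complex) set"
  where "taylor_spectrum A B =
    {(z, w). \<not> koszul_exact (\<lambda>x. A x - z *\<^sub>C x) (\<lambda>x. B x - w *\<^sub>C x)}"

definition geometric_spectral_radius ::
    "('a::complex_hilbert_space \<Rightarrow> 'a) \<Rightarrow> ('a \<Rightarrow> 'a) \<Rightarrow> real"
  where "geometric_spectral_radius A B =
    (GREATEST r. r \<in> {sqrt ((cmod z)\<^sup>2 + (cmod w)\<^sup>2) | z w. (z, w) \<in> taylor_spectrum A B})"

definition block_op ::
    "('a::complex_hilbert_space \<Rightarrow> 'a) \<Rightarrow> ('b::complex_hilbert_space \<Rightarrow> 'a) \<Rightarrow> ('b \<Rightarrow> 'b) \<Rightarrow>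
      'a \<times> 'b \<Rightarrow> 'a \<times> 'b"
  where "block_op V E Q = (\<lambda>(x, y). (V x + E y, Q y))"

definition class_Q ::
    "('a::complex_hilbert_space \<times> 'b::complex_hilbert_space \<Rightarrow> 'a \<times> 'b) \<Rightarrow>
      ('a \<Rightarrow> 'a) \<Rightarrow> ('b \<Rightarrow> 'a) \<Rightarrow> ('b \<Rightarrow> 'b) \<Rightarrow> bool"
  where "class_Q T V E Q \<longleftrightarrow>
    bounded_clinear T \<and> T = block_op V E Q \<and>
    bounded_clinear V \<and> bounded_clinear E \<and> bounded_clinear Q \<and>
    cadjoint V \<circ> V = id \<and>
    cadjoint V \<circ> E = (\<lambda>_. 0) \<and>
    Q \<circ> cadjoint E \<circ> E = cadjoint E \<circ> E \<circ> Q \<and>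
    quasinormal Q"

end

(*
The defining relations of the class give |T(x, y)|^2 = |x|^2 + |Ey|^2 + |Qy|^2, so the square of the
norm of T is the maximum of 1 and the supremum m of the quadratic form of S = |Q|^2 + |E|^2 on the
unit sphere. If |z|^2 + |w|^2 > m, an explicit homotopy shows that the Koszul complex of
(|Q| - z, |E| - w) is exact. Conversely, m is an approximate eigenvalue of S; maximising the form of
|Q| over approximate eigenvectors of S at m, and then that of |E| over the resulting approximate
eigenvectors, yields joint approximate eigenvectors for a point (a, b) with a^2 + b^2 = m, and by
Baire's theorem the last Koszul map is not surjective at (a, b).
*)
theory Submission
  imports Defs
begin

section \<open>Real inner product and adjoints\<close>

text \<open>\<open>cadjoint\<close> and \<open>sqrt_op\<close> are unique descriptions and the
  radius is a \<open>GREATEST\<close>, so each must first be shown to denote something: adjoints by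
  Riesz representation, square roots by a convergent iteration, the radius by a point of the
  spectrum at which the bound for all other points is attained. The iterates are polynomials in one
  operator, so whatever commutes with that operator commutes with its root; this yields both the
  uniqueness of roots and the commutativity of |Q| and |E|. No joint spectral measure is available;
  suprema of real quadratic forms replace it, which is why the real part of the inner product
  carries most of the argument. If \<alpha> is the supremum of the form of A, then \<alpha> - A is
  positive, and Cauchy-Schwarz for its form turns a near-maximiser into an approximate eigenvector.
  The obstacle is to repeat this inside the approximate eigenvectors of another operator, which form
  no subspace: positivity then holds only up to a small error. Treating S first forces a^2 + b^2 = m
  for any joint approximate eigenvalue found afterwards.\<close>

definition rinner :: "'a::complex_hilbert_space \<Rightarrow> 'a \<Rightarrow> real"
  where "rinner x y = Re (cinner x y)"

lemma cinner_add_right: "cinner x (y + z) = cinner x y + cinner x z"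
  by (metis cinner_add_left cinner_commute complex_cnj_add)

lemma cinner_scaleC_right: "cinner x (c *\<^sub>C y) = cnj c * cinner x y"
  by (metis cinner_scaleC_left cinner_commute complex_cnj_mult)

lemma scaleR_eq_scaleC: "r *\<^sub>R x = complex_of_real r *\<^sub>C (x::'a::complex_hilbert_space)"
  by (simp add: scaleC_of_real)

lemma rinner_add_left: "rinner (x + y) z = rinner x z + rinner y z"
  by (simp add: rinner_def cinner_add_left)

lemma rinner_commute: "rinner x y = rinner y x"
  unfolding rinner_def by (subst cinner_commute) simp

lemma rinner_add_right: "rinner x (y + z) = rinner x y + rinner x z"
  by (simp add: rinner_def cinner_add_right)

lemma rinner_scaleR_left [simp]: "rinner (r *\<^sub>R x) y = r * rinner x y"
  by (simp add: rinner_def scaleR_eq_scaleC cinner_scaleC_left)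

lemma rinner_scaleR_right [simp]: "rinner x (r *\<^sub>R y) = r * rinner x y"
  by (simp add: rinner_def scaleR_eq_scaleC cinner_scaleC_right)

lemma rinner_minus_left [simp]: "rinner (- x) y = - rinner x y"
  using rinner_scaleR_left[of "-1" x y] by simp

lemma rinner_minus_right [simp]: "rinner x (- y) = - rinner x y"
  using rinner_scaleR_right[of x "-1" y] by simp

lemma rinner_diff_left: "rinner (x - y) z = rinner x z - rinner y z"
  using rinner_add_left[of x "- y" z] by simp

lemma rinner_diff_right: "rinner x (y - z) = rinner x y - rinner x z"
  using rinner_add_right[of x y "- z"] by simp

lemma rinner_zero [simp]: "rinner 0 y = 0" "rinner x 0 = 0"
  using rinner_scaleR_left[of 0 0 y] rinner_scaleR_right[of x 0 0] by simp_all

lemmas rinner_simps = rinner_add_left rinner_add_right rinner_diff_left rinner_diff_right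

lemma rinner_self: "rinner x x = (norm x)\<^sup>2"
  by (simp add: rinner_def cinner_self)

text \<open>Reduces identities between complex inner products to their real parts, provided that
  scalars can be moved through the operators involved.\<close>

lemma Im_cinner: "Im (cinner x y) = rinner ((- \<i>) *\<^sub>C x) y"
  by (simp add: rinner_def cinner_scaleC_left)

lemma norm_add_sq: "(norm (x + y))\<^sup>2 = (norm x)\<^sup>2 + 2 * rinner x y + (norm (y::'a::complex_hilbert_space))\<^sup>2"
  using rinner_commute[of x y] by (simp add: rinner_simps flip: rinner_self)

lemma norm_diff_sq: "(norm (x - y))\<^sup>2 = (norm x)\<^sup>2 - 2 * rinner x y + (norm (y::'a::complex_hilbert_space))\<^sup>2"
  using rinner_commute[of x y] by (simp add: rinner_simps flip: rinner_self)

text \<open>First variation at a minimum: for small \<open>t\<close> the linear term dominates. It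
  serves for the Riesz minimiser and for null vectors of positive forms.\<close>

lemma quadratic_nonneg_imp_zero:
  fixes b c :: real
  assumes "\<And>t. 0 \<le> 2 * t * b + t\<^sup>2 * c"
  shows "b = 0"
proof -
  \<comment> \<open>The minimiser of \<open>2 * t * b + t\<^sup>2 * (\<bar>c\<bar> + 1)\<close>; the
    summand 1 keeps the denominator positive when \<open>c = 0\<close>.\<close>
  define t where "t = - b / (\<bar>c\<bar> + 1)"
  have p: "\<bar>c\<bar> + 1 > 0" by simp
  have b: "b = - t * (\<bar>c\<bar> + 1)" using p by (simp add: t_def)
  have "0 \<le> 2 * t * b + t\<^sup>2 * \<bar>c\<bar>"
    using assms[of t] mult_left_mono[OF abs_ge_self[of c] zero_le_power2[of t]] by linarith
  also have "\<dots> = - (t\<^sup>2 * (\<bar>c\<bar> + 2))" by (simp add: b power2_eq_square algebra_simps)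
  finally have "t\<^sup>2 * (\<bar>c\<bar> + 2) \<le> 0" by simp
  then have "t = 0" by (smt (verit) mult_pos_pos zero_less_power2)
  with b show ?thesis by simp
qed

lemma rinner_le_norm: "\<bar>rinner x y\<bar> \<le> norm x * norm y"
proof (cases "y = 0")
  case False
  then have ny: "(norm y)\<^sup>2 > 0" by simp
  define r where "r = rinner x y / (norm y)\<^sup>2"
  have r: "rinner x y = r * (norm y)\<^sup>2" using ny by (simp add: r_def)
  have "0 \<le> (norm (x - r *\<^sub>R y))\<^sup>2" by simp
  also have "\<dots> = (norm x)\<^sup>2 - r\<^sup>2 * (norm y)\<^sup>2"
    unfolding norm_diff_sq by (simp add: r power_mult_distrib power2_eq_square)
  finally have "r\<^sup>2 * (norm y)\<^sup>2 \<le> (norm x)\<^sup>2" by simp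
  then have "r\<^sup>2 * (norm y)\<^sup>2 * (norm y)\<^sup>2 \<le> (norm x)\<^sup>2 * (norm y)\<^sup>2"
    by (rule mult_right_mono) simp
  then have "(rinner x y)\<^sup>2 \<le> (norm x * norm y)\<^sup>2"
    by (simp add: r power_mult_distrib power2_eq_square algebra_simps)
  then show ?thesis by (metis abs_le_square_iff abs_mult abs_norm_cancel)
qed simp

lemma rinner_le: "rinner x y \<le> norm x * norm y"
  using rinner_le_norm[of x y] by linarith

lemma bounded_linear_rinner_left: "bounded_linear (\<lambda>x. rinner x y)"
  by (rule bounded_linear_intro[where K = "norm y"])
    (simp_all add: rinner_simps rinner_le_norm)

lemma bounded_linear_rinner_right: "bounded_linear (\<lambda>y. rinner x y)"
  using bounded_linear_rinner_left[of x] by (simp add: rinner_commute)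

lemma rinner_eqI:
  assumes "\<And>x. rinner x y = rinner x z"
  shows "y = z"
proof -
  have "rinner (y - z) (y - z) = 0" using assms by (simp add: rinner_diff_right)
  then show ?thesis by (simp add: rinner_self)
qed

lemma cinner_eqI:
  assumes "\<And>x. cinner x y = cinner x z"
  shows "y = z"
  by (rule rinner_eqI) (simp add: rinner_def assms)

lemma norm_scaleC: "norm (c *\<^sub>C x) = cmod c * norm (x::'a::complex_hilbert_space)"
proof -
  have "complex_of_real ((norm (c *\<^sub>C x))\<^sup>2) = c * cnj c * complex_of_real ((norm x)\<^sup>2)"
    unfolding cinner_self[symmetric] by (simp add: cinner_scaleC_left cinner_scaleC_right mult.assoc)
  also have "\<dots> = complex_of_real ((cmod c * norm x)\<^sup>2)"
    unfolding complex_norm_square[symmetric] by (simp add: power_mult_distrib)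
  finally have "(norm (c *\<^sub>C x))\<^sup>2 = (cmod c * norm x)\<^sup>2" using of_real_eq_iff by blast
  then show ?thesis by simp
qed

lemma bounded_clinear_scaleC: "bounded_clinear (\<lambda>x. c *\<^sub>C x)"
  unfolding bounded_clinear_def
proof
  show "bounded_linear (\<lambda>x::'a. c *\<^sub>C x)"
    by (rule bounded_linear_intro[where K = "cmod c"])
      (simp_all add: scaleC_add_right norm_scaleC scaleR_eq_scaleC scaleC_scaleC mult.commute)
qed (simp add: scaleC_scaleC mult.commute)

lemma bounded_clinear_imp:
  assumes "bounded_clinear A"
  shows "bounded_linear A" "A (c *\<^sub>C x) = c *\<^sub>C A x" "A (x + y) = A x + A y" "A (x - y) = A x - A y"
    "A (r *\<^sub>R x) = r *\<^sub>R A x" "A 0 = 0" "A (- x) = - A x"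
  using assms by (auto simp: bounded_clinear_def linear_simps)

text \<open>The representing vector minimises the strictly convex functional \<open>\<parallel>x\<parallel>\<^sup>2 - 2 f x\<close>; minimising
  sequences are Cauchy by the parallelogram law.\<close>

lemma riesz:
  fixes f :: "'a::complex_hilbert_space \<Rightarrow> real"
  assumes "bounded_linear f"
  obtains z where "\<And>x. f x = rinner x z"
proof -
  interpret bounded_linear f by fact
  define \<phi> where "\<phi> x = (norm x)\<^sup>2 - 2 * f x" for x
  obtain K where K: "\<And>x. norm (f x) \<le> norm x * K" using bounded by blast
  have "\<phi> x \<ge> - K\<^sup>2" for x
  proof -
    have "f x \<le> norm x * K" using K[of x] by simp
    moreover have "0 \<le> (norm x - K)\<^sup>2" by simp
    ultimately show ?thesis by (simp add: \<phi>_def power2_diff)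
  qed
  then have bdd: "bdd_below (range \<phi>)" by (intro bdd_belowI2) auto
  define m where "m = Inf (range \<phi>)"
  have m: "m \<le> \<phi> x" for x unfolding m_def by (rule cInf_lower) (use bdd in auto)
  have "\<exists>x. \<phi> x < m + inverse (real (Suc n))" for n
    using cInf_lessD[of "range \<phi>" "m + inverse (real (Suc n))"] by (auto simp: m_def)
  then obtain X where X: "\<And>n. \<phi> (X n) < m + inverse (real (Suc n))" by metis
  have par: "(norm (a - b))\<^sup>2 \<le> 2 * (\<phi> a - m) + 2 * (\<phi> b - m)" for a b
  proof -
    have "(norm (a - b))\<^sup>2 = 2 * \<phi> a + 2 * \<phi> b - 4 * \<phi> ((1/2) *\<^sub>R (a + b))"
    proof -
      have "(norm ((1/2) *\<^sub>R (a + b)))\<^sup>2 = (norm (a + b))\<^sup>2 / 4" by (simp add: power_divide)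
      moreover have "f ((1/2) *\<^sub>R (a + b)) = (f a + f b) / 2" by (simp only: scaleR add) simp
      ultimately show ?thesis unfolding \<phi>_def norm_add_sq norm_diff_sq by simp
    qed
    then show ?thesis using m[of "(1/2) *\<^sub>R (a + b)"] by simp
  qed
  have "Cauchy X"
  proof (rule metric_CauchyI)
    fix e :: real assume e: "e > 0"
    then have "e\<^sup>2 / 4 > 0" by simp
    then obtain N where N: "inverse (real (Suc N)) < e\<^sup>2 / 4" using reals_Archimedean by blast
    have *: "\<phi> (X n) - m < e\<^sup>2 / 4" if "n \<ge> N" for n
    proof -
      have "inverse (real (Suc n)) \<le> inverse (real (Suc N))" using that by simp
      then show ?thesis using X[of n] N by linarith
    qed
    have "dist (X k) (X n) < e" if "k \<ge> N" "n \<ge> N" for k n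
    proof -
      have "2 * (\<phi> (X k) - m) + 2 * (\<phi> (X n) - m) < e\<^sup>2" using *[OF that(1)] *[OF that(2)] by argo
      then have "(norm (X k - X n))\<^sup>2 < e\<^sup>2" using par[of "X k" "X n"] by simp
      then show ?thesis using e by (simp add: dist_norm power2_less_imp_less)
    qed
    then show "\<exists>M. \<forall>m\<ge>M. \<forall>n\<ge>M. dist (X m) (X n) < e" by blast
  qed
  then obtain z where z: "X \<longlonglongrightarrow> z" using Cauchy_convergent convergent_def by blast
  have "(\<lambda>n. \<phi> (X n)) \<longlonglongrightarrow> \<phi> z" unfolding \<phi>_def by (intro tendsto_intros tendsto z)
  moreover have "(\<lambda>n. m + inverse (real (Suc n))) \<longlonglongrightarrow> m + 0"
    by (intro tendsto_intros LIMSEQ_inverse_real_of_nat)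
  ultimately have "\<phi> z \<le> m + 0" by (rule LIMSEQ_le) (use X less_imp_le in blast)
  then have min: "\<phi> z \<le> \<phi> x" for x using m[of x] by simp
  have "rinner x z - f x = 0" for x
  proof (rule quadratic_nonneg_imp_zero)
    fix t :: real
    have "\<phi> (z + t *\<^sub>R x) = \<phi> z + 2 * t * (rinner x z - f x) + t\<^sup>2 * (norm x)\<^sup>2"
      unfolding \<phi>_def norm_add_sq add scaleR rinner_commute[of z]
      by (simp add: power_mult_distrib right_diff_distrib)
    then show "0 \<le> 2 * t * (rinner x z - f x) + t\<^sup>2 * (norm x)\<^sup>2" using min[of "z + t *\<^sub>R x"] by simp
  qed
  then have "f x = rinner x z" for x by simp
  then show thesis using that by blast
qed

lemma cadjoint_exists:
  fixes A :: "'a::complex_hilbert_space \<Rightarrow> 'b::complex_hilbert_space"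
  assumes A: "bounded_clinear A"
  obtains B where "bounded_clinear B" "\<And>x y. cinner (A x) y = cinner x (B y)"
proof -
  have "\<exists>z. \<forall>x. rinner (A x) y = rinner x z" for y
    by (rule riesz[OF bounded_linear_compose[OF bounded_linear_rinner_left[of y] bounded_clinear_imp(1)[OF A]]]) blast
  then obtain B where B: "\<And>x y. rinner (A x) y = rinner x (B y)" by metis
  \<comment> \<open>Riesz only gives equality of real parts; complex linearity of \<open>A\<close>
    upgrades it by rotating \<open>x\<close>.\<close>
  have c: "cinner (A x) y = cinner x (B y)" for x y
  proof (rule complex_eqI)
    show "Re (cinner (A x) y) = Re (cinner x (B y))" using B by (simp add: rinner_def)
    show "Im (cinner (A x) y) = Im (cinner x (B y))"
      unfolding Im_cinner bounded_clinear_imp(2)[OF A, symmetric] by (rule B)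
  qed
  obtain K where K: "\<And>x. norm (A x) \<le> norm x * K" "0 \<le> K"
    using bounded_linear.nonneg_bounded[OF bounded_clinear_imp(1)[OF A]] by blast
  have add: "B (x + y) = B x + B y" for x y
    by (rule cinner_eqI) (simp add: cinner_add_right flip: c)
  have sc: "B (k *\<^sub>C x) = k *\<^sub>C B x" for k x
    by (rule cinner_eqI) (simp add: cinner_scaleC_right flip: c)
  have bd: "norm (B y) \<le> norm y * K" for y
  proof -
    have "(norm (B y))\<^sup>2 = rinner (A (B y)) y" by (simp add: B rinner_self)
    also have "\<dots> \<le> norm (A (B y)) * norm y" by (rule rinner_le)
    also have "\<dots> \<le> norm (B y) * K * norm y" by (intro mult_right_mono K) simp
    finally have "norm (B y) * norm (B y) \<le> norm (B y) * (norm y * K)"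
      by (simp add: power2_eq_square mult_ac)
    then show ?thesis
      using K(2) by (cases "norm (B y) = 0") (auto simp: mult_le_cancel_left)
  qed
  have "bounded_linear B"
    by (rule bounded_linear_intro[OF add _ bd]) (simp add: scaleR_eq_scaleC sc)
  then have "bounded_clinear B" using sc by (simp add: bounded_clinear_def)
  then show thesis using c by (rule that)
qed

lemma cadjoint:
  assumes "bounded_clinear A"
  shows "bounded_clinear (cadjoint A)" "cinner (A x) y = cinner x (cadjoint A y)"
proof -
  obtain B where B: "bounded_clinear B" "\<And>x y. cinner (A x) y = cinner x (B y)"
    by (rule cadjoint_exists[OF assms]) (rule that)
  have "cadjoint A = B"
    unfolding cadjoint_def
  proof (rule the_equality)
    fix C assume C: "\<forall>x y. cinner (A x) y = cinner x (C y)"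
    have "C y = B y" for y by (rule cinner_eqI) (simp flip: C B(2))
    then show "C = B" ..
  qed (simp add: B(2))
  with B show "bounded_clinear (cadjoint A)" "cinner (A x) y = cinner x (cadjoint A y)" by simp_all
qed

lemma rinner_cadjoint:
  assumes "bounded_clinear A"
  shows "rinner (A x) y = rinner x (cadjoint A y)" "rinner (cadjoint A y) x = rinner y (A x)"
proof -
  show "rinner (A x) y = rinner x (cadjoint A y)" by (simp add: rinner_def cadjoint(2)[OF assms])
  then show "rinner (cadjoint A y) x = rinner y (A x)" by (metis rinner_commute)
qed

lemma cadjoint_norm_le:
  assumes "bounded_clinear A" "\<And>x. norm (A x) \<le> K * norm x" "0 \<le> K"
  shows "norm (cadjoint A y) \<le> K * norm y"
proof -
  have "(norm (cadjoint A y))\<^sup>2 = rinner (A (cadjoint A y)) y"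
    by (simp add: rinner_cadjoint(1)[OF assms(1)] rinner_self)
  also have "\<dots> \<le> norm (A (cadjoint A y)) * norm y" by (rule rinner_le)
  also have "\<dots> \<le> K * norm (cadjoint A y) * norm y" by (intro mult_right_mono assms) simp
  finally have "norm (cadjoint A y) * norm (cadjoint A y) \<le> norm (cadjoint A y) * (K * norm y)"
    by (simp add: power2_eq_square mult_ac)
  then show ?thesis
    using assms(3) by (cases "norm (cadjoint A y) = 0") (auto simp: mult_le_cancel_left)
qed

text \<open>The adjoint of the relation A S = S A. With S = E*E and A = Q it makes E*E commute with
  Q* as well as with Q.\<close>

lemma cadjoint_adjoint_commute:
  assumes A: "bounded_clinear A" and S: "\<And>x y. rinner (S x) y = rinner x (S y)" and "\<And>x. A (S x) = S (A x)"
  shows "cadjoint A (S x) = S (cadjoint A x)"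
proof (rule rinner_eqI)
  fix y
  have "rinner y (cadjoint A (S x)) = rinner (A y) (S x)" by (rule rinner_cadjoint(1)[OF A, symmetric])
  also have "\<dots> = rinner (A (S y)) x" by (simp only: assms(3) S)
  also have "\<dots> = rinner y (S (cadjoint A x))" by (simp only: rinner_cadjoint(1)[OF A] S)
  finally show "rinner y (cadjoint A (S x)) = rinner y (S (cadjoint A x))" .
qed

section \<open>Square roots\<close>

lemma bounded_clinear_compose:
  "bounded_clinear A \<Longrightarrow> bounded_clinear B \<Longrightarrow> bounded_clinear (\<lambda>x. A (B x))"
  using bounded_linear_compose[of A B] by (simp add: bounded_clinear_def)

lemma bounded_clinear_add:
  "bounded_clinear A \<Longrightarrow> bounded_clinear B \<Longrightarrow> bounded_clinear (\<lambda>x. A x + B x)"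
  using bounded_linear_add[of A B] by (simp add: bounded_clinear_def scaleC_add_right)

lemma scaleC_scaleR: "c *\<^sub>C r *\<^sub>R x = r *\<^sub>R c *\<^sub>C (x::'a::complex_hilbert_space)"
  by (simp add: scaleR_eq_scaleC scaleC_scaleC mult.commute)

lemma scaleC_minus: "c *\<^sub>C (- x) = - (c *\<^sub>C (x::'a::complex_hilbert_space))"
  using scaleC_scaleR[of c "-1" x] by simp

lemma scaleC_diff_right: "c *\<^sub>C (x - y) = c *\<^sub>C x - c *\<^sub>C (y::'a::complex_hilbert_space)"
  using scaleC_add_right[of c x "- y"] by (simp add: scaleC_minus)

lemma bounded_clinear_diff:
  "bounded_clinear A \<Longrightarrow> bounded_clinear B \<Longrightarrow> bounded_clinear (\<lambda>x. A x - B x)"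
  using bounded_linear_sub[of A B] by (simp add: bounded_clinear_def scaleC_diff_right)

lemma bounded_clinear_scaleR:
  "bounded_clinear A \<Longrightarrow> bounded_clinear (\<lambda>x. r *\<^sub>R A x)"
  using bounded_linear_const_scaleR[of A r] by (simp add: bounded_clinear_def scaleC_scaleR)

lemma bounded_clinear_id: "bounded_clinear (\<lambda>x. x)"
  by (simp add: bounded_clinear_def)

lemma scaleC_zero_right [simp]: "c *\<^sub>C (0::'a::complex_hilbert_space) = 0"
  using scaleC_diff_right[of c 0 "0::'a"] by simp

lemma bounded_clinear_zero: "bounded_clinear (\<lambda>x. 0)"
  by (simp add: bounded_clinear_def)

lemma scaleC_LIMSEQ:
  fixes X :: "nat \<Rightarrow> 'a::complex_hilbert_space"
  shows "X \<longlonglongrightarrow> x \<Longrightarrow> (\<lambda>n. c *\<^sub>C X n) \<longlonglongrightarrow> c *\<^sub>C x"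
  by (rule bounded_linear.tendsto[OF bounded_clinear_imp(1)[OF bounded_clinear_scaleC]])

text \<open>Visser's iteration for \<open>1 - sqrt (1 - R)\<close>, and its scalar majorant (the case \<open>R = 1\<close>).\<close>

fun sqrt_iter :: "('a::real_normed_vector \<Rightarrow> 'a) \<Rightarrow> nat \<Rightarrow> 'a \<Rightarrow> 'a" where
  "sqrt_iter R 0 = (\<lambda>x. 0)"
| "sqrt_iter R (Suc n) = (\<lambda>x. (1/2) *\<^sub>R (R x + sqrt_iter R n (sqrt_iter R n x)))"

fun sqrt_iter_real :: "nat \<Rightarrow> real" where
  "sqrt_iter_real 0 = 0"
| "sqrt_iter_real (Suc n) = (1 + (sqrt_iter_real n)\<^sup>2) / 2"

lemma sqrt_iter_real_bounds: "0 \<le> sqrt_iter_real n" "sqrt_iter_real n \<le> 1"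
proof (induction n)
  case (Suc n)
  { case 1 then show ?case using Suc by simp }
  { case 2 then show ?case using Suc power_le_one[of "sqrt_iter_real n" 2] by simp }
qed simp_all

lemma sqrt_iter_real_mono: "sqrt_iter_real n \<le> sqrt_iter_real (Suc n)"
proof -
  have "0 \<le> (1 - sqrt_iter_real n)\<^sup>2" by simp
  then show ?thesis by (simp add: power2_diff)
qed

context
  fixes R :: "'a::complex_hilbert_space \<Rightarrow> 'a"
  assumes R: "bounded_clinear R" and R_norm: "\<And>x. norm (R x) \<le> norm x"
begin

private abbreviation (input) "P \<equiv> sqrt_iter R"
private abbreviation (input) "p \<equiv> sqrt_iter_real"

lemma sqrt_iter_bounded_clinear: "bounded_clinear (P n)"
proof (induction n)
  case (Suc n)
  then show ?case
    unfolding sqrt_iter.simps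
    by (intro bounded_clinear_scaleR bounded_clinear_add R) (rule bounded_clinear_compose)
qed (simp add: bounded_clinear_zero)

text \<open>Each iterate is a polynomial in \<open>R\<close>. The property survives the limit and
  determines what commutes with the square root.\<close>

lemma sqrt_iter_commute:
  assumes "bounded_clinear C" "\<And>x. C (R x) = R (C x)"
  shows "C (P n x) = P n (C x)"
  by (induction n arbitrary: x) (simp_all add: bounded_clinear_imp[OF assms(1)] assms(2))

lemma sqrt_iter_sqrt_iter_commute: "P m (P n x) = P n (P m x)"
  by (rule sqrt_iter_commute[OF sqrt_iter_bounded_clinear]) (rule sqrt_iter_commute[OF R refl, symmetric])

lemma sqrt_iter_norm: "norm (P n x) \<le> p n * norm x"
proof (induction n arbitrary: x)
  case (Suc n)
  have "norm (P n (P n x)) \<le> p n * (p n * norm x)"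
    using Suc[of "P n x"] Suc[of x] sqrt_iter_real_bounds(1)[of n] by (meson mult_left_mono order_trans)
  then have "norm (R x + P n (P n x)) \<le> norm x + p n * (p n * norm x)"
    using norm_triangle_ineq[of "R x" "P n (P n x)"] R_norm[of x] by linarith
  then have "norm (P (Suc n) x) \<le> (norm x + p n * (p n * norm x)) / 2"
    unfolding sqrt_iter.simps norm_scaleR by simp
  then show ?case by (simp add: power2_eq_square algebra_simps add_divide_distrib)
qed simp

text \<open>Since iterates commute, half the difference of two consecutive squares factors as
  \<open>(1/2)\<close> times difference times sum. The scalar sequence satisfies the same identity,
  so the estimate propagates by induction.\<close>

lemma sqrt_iter_step: "norm (P (Suc n) x - P n x) \<le> (p (Suc n) - p n) * norm x"
proof (induction n arbitrary: x)
  case 0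
  then show ?case using R_norm by simp
next
  case (Suc n)
  let ?y = "P (Suc n) x + P n x"
  note L = bounded_clinear_imp[OF sqrt_iter_bounded_clinear]
  have "P (Suc n) ?y - P n ?y = P (Suc n) (P (Suc n) x) - P n (P n x)"
    using sqrt_iter_sqrt_iter_commute[of n "Suc n" x] by (simp only: L) simp
  then have eq: "P (Suc (Suc n)) x - P (Suc n) x = (1/2) *\<^sub>R (P (Suc n) ?y - P n ?y)"
    unfolding sqrt_iter.simps(2)[of R "Suc n"] sqrt_iter.simps(2)[of R n, THEN fun_cong, of x]
    by (simp only: scaleR_diff_right[symmetric] add_diff_cancel_left)
  have "norm ?y \<le> (p (Suc n) + p n) * norm x"
    using norm_triangle_ineq[of "P (Suc n) x" "P n x"] sqrt_iter_norm[of "Suc n" x] sqrt_iter_norm[of n x]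
    by (simp only: distrib_right)
  then have "(p (Suc n) - p n) * norm ?y \<le> (p (Suc n) - p n) * ((p (Suc n) + p n) * norm x)"
    by (rule mult_left_mono) (use sqrt_iter_real_mono[of n] in simp)
  with Suc[of ?y] have "norm (P (Suc n) ?y - P n ?y) \<le> (p (Suc n) - p n) * ((p (Suc n) + p n) * norm x)"
    by (rule order_trans)
  moreover have "p (Suc (Suc n)) - p (Suc n) = (p (Suc n) - p n) * (p (Suc n) + p n) / 2"
    unfolding sqrt_iter_real.simps(2)[of "Suc n"] sqrt_iter_real.simps(2)[of n]
    by (simp add: power2_eq_square field_simps)
  ultimately show ?case unfolding eq by (simp only: norm_scaleR) (simp add: mult.assoc)
qed

lemma sqrt_iter_diff: "m \<le> n \<Longrightarrow> norm (P n x - P m x) \<le> (p n - p m) * norm x"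
proof (induction n rule: dec_induct)
  case (step n)
  have "norm (P (Suc n) x - P m x) \<le> norm (P (Suc n) x - P n x) + norm (P n x - P m x)"
    unfolding dist_norm[symmetric] by (rule dist_triangle)
  also have "\<dots> \<le> (p (Suc n) - p n) * norm x + (p n - p m) * norm x"
    by (intro add_mono sqrt_iter_step step.IH)
  finally show ?case by (simp add: algebra_simps)
qed simp

lemma sqrt_iter_LIMSEQ: "\<exists>y. (\<lambda>n. P n x) \<longlonglongrightarrow> y"
proof -
  have "incseq p" using sqrt_iter_real_mono by (rule incseq_SucI)
  then have "convergent p"
    by (rule incseq_convergent[of p 1]) (simp_all add: sqrt_iter_real_bounds convergentI)
  then have cp: "Cauchy p" by (rule convergent_Cauchy)
  have "Cauchy (\<lambda>n. P n x)"
  proof (rule metric_CauchyI)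
    fix e :: real assume e: "e > 0"
    then have "e / (norm x + 1) > 0" by (simp add: add_nonneg_pos)
    then obtain N where N: "\<And>m n. m \<ge> N \<Longrightarrow> n \<ge> N \<Longrightarrow> dist (p m) (p n) < e / (norm x + 1)"
      using metric_CauchyD[OF cp] by blast
    have *: "dist (P n x) (P m x) < e" if "m \<ge> N" "m \<le> n" for m n
    proof -
      have "p n - p m \<le> e / (norm x + 1)" using N[of m n] that by (simp add: dist_real_def)
      then have "(p n - p m) * (norm x + 1) \<le> e" by (simp add: pos_le_divide_eq add_nonneg_pos)
      moreover have "dist (P n x) (P m x) \<le> (p n - p m) * norm x"
        using sqrt_iter_diff[OF that(2)] by (simp add: dist_norm)
      \<comment> \<open>Replacing \<open>norm x + 1\<close> by \<open>norm x\<close> makes the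
        estimate strict if the difference is positive; if it is zero, \<open>e > 0\<close>
        suffices.\<close>
      moreover have "p m < p n \<or> p m = p n"
        using incseqD[OF \<open>incseq p\<close> that(2)] by linarith
      ultimately show ?thesis using e by (auto simp: algebra_simps)
    qed
    show "\<exists>M. \<forall>m\<ge>M. \<forall>n\<ge>M. dist (P m x) (P n x) < e"
    proof (intro exI allI impI)
      fix m n assume "N \<le> m" "N \<le> n"
      then show "dist (P m x) (P n x) < e"
        using *[of m n] *[of n m] nat_le_linear[of m n] by (auto simp: dist_commute)
    qed
  qed
  then show ?thesis using Cauchy_convergent convergent_def by blast
qed

text \<open>The limit \<open>L\<close> of the iterates satisfies 2 L = R + L^2, that is (1 - L)^2 =
  1 - R, and \<open>S\<close> is 1 - L. Positivity holds because \<open>L\<close> is a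
  contraction.\<close>

lemma one_minus_has_sqrt:
  assumes sa: "\<And>x y. rinner (R x) y = rinner x (R y)"
  obtains S where "bounded_clinear S" "\<And>x. S (S x) = x - R x" "\<And>x y. rinner (S x) y = rinner x (S y)"
    "\<And>x. 0 \<le> rinner (S x) x"
    "\<forall>C. bounded_clinear C \<longrightarrow> (\<forall>x. C (R x) = R (C x)) \<longrightarrow> (\<forall>x. C (S x) = S (C x))"
proof -
  obtain L where L: "\<And>x. (\<lambda>n. P n x) \<longlonglongrightarrow> L x" using sqrt_iter_LIMSEQ by metis
  note PL = bounded_clinear_imp[OF sqrt_iter_bounded_clinear]
  have Pn: "norm (P n x) \<le> norm x" for n x
    using sqrt_iter_norm[of n x] mult_right_mono[OF sqrt_iter_real_bounds(2)[of n], of "norm x"] by simp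
  have add: "L (x + y) = L x + L y" for x y
    using LIMSEQ_unique[OF L[of "x + y"]] tendsto_add[OF L[of x] L[of y]] by (simp only: PL)
  have sc: "L (c *\<^sub>C x) = c *\<^sub>C L x" for c x
    using LIMSEQ_unique[OF L[of "c *\<^sub>C x"]] scaleC_LIMSEQ[OF L[of x], of c] by (simp only: PL)
  have nL: "norm (L x) \<le> norm x" for x
    by (rule LIMSEQ_le_const2[OF tendsto_norm[OF L[of x]]]) (use Pn in blast)
  have bL: "bounded_clinear L"
    unfolding bounded_clinear_def
  proof
    show "bounded_linear L"
      by (rule bounded_linear_intro[where K = 1, OF add]) (simp_all add: scaleR_eq_scaleC sc nL)
  qed (simp add: sc)
  \<comment> \<open>Operator and argument both vary with \<open>n\<close>; since all iterates are
    contractions, replacing the inner \<open>P n x\<close> by \<open>L x\<close> costs an error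
    tending to 0.\<close>
  have LL: "(\<lambda>n. P n (P n x)) \<longlonglongrightarrow> L (L x)" for x
  proof -
    have "(\<lambda>n. P n (P n x - L x)) \<longlonglongrightarrow> 0"
    proof (rule Lim_null_comparison)
      show "\<forall>\<^sub>F n in sequentially. norm (P n (P n x - L x)) \<le> norm (P n x - L x)" using Pn by simp
      show "(\<lambda>n. norm (P n x - L x)) \<longlonglongrightarrow> 0" using L LIM_zero tendsto_norm_zero by blast
    qed
    from tendsto_add[OF this L[of "L x"]] show ?thesis by (simp add: PL(4))
  qed
  have step: "L x = (1/2) *\<^sub>R (R x + L (L x))" for x
  proof (rule LIMSEQ_unique[OF LIMSEQ_Suc[OF L[of x]]])
    show "(\<lambda>n. P (Suc n) x) \<longlonglongrightarrow> (1/2) *\<^sub>R (R x + L (L x))"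
      unfolding sqrt_iter.simps by (intro tendsto_intros LL)
  qed
  have "L x + L x = R x + L (L x)" for x
  proof -
    have "L x + L x = 2 *\<^sub>R L x" by (simp add: scaleR_2)
    also have "\<dots> = 2 *\<^sub>R (1/2) *\<^sub>R (R x + L (L x))" by (simp only: step[of x, symmetric])
    also have "\<dots> = R x + L (L x)" by (simp only: scaleR_scaleR) simp
    finally show ?thesis .
  qed
  then have sq: "L x + L x - L (L x) = R x" for x by simp
  have Psa: "rinner (P n x) y = rinner x (P n y)" for n x y
    by (induction n arbitrary: x y) (simp_all add: sa rinner_simps)
  have Lsa: "rinner (L x) y = rinner x (L y)" for x y
    using LIMSEQ_unique[OF bounded_linear.tendsto[OF bounded_linear_rinner_left L]]
      bounded_linear.tendsto[OF bounded_linear_rinner_right L] by (simp only: Psa)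
  note BL = bounded_clinear_imp[OF bL]
  show thesis
  proof
    show "bounded_clinear (\<lambda>x. x - L x)" by (intro bounded_clinear_diff bounded_clinear_id bL)
    show "x - L x - L (x - L x) = x - R x" for x unfolding BL sq[symmetric] by simp
    show "rinner (x - L x) y = rinner x (y - L y)" for x y by (simp add: rinner_simps Lsa)
    show "0 \<le> rinner (x - L x) x" for x
    proof -
      have "rinner (L x) x \<le> norm x * norm x"
        using rinner_le[of "L x" x] mult_right_mono[OF nL[of x], of "norm x"] by simp
      then show ?thesis by (simp add: rinner_simps rinner_self power2_eq_square)
    qed
    have "C (x - L x) = C x - L (C x)" if C: "bounded_clinear C" "\<forall>x. C (R x) = R (C x)" for C x
    proof -
      note CP = sqrt_iter_commute[OF C(1) C(2)[rule_format]]
      have "C (L x) = L (C x)"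
        using LIMSEQ_unique[OF bounded_linear.tendsto[OF bounded_clinear_imp(1)[OF C(1)] L[of x]]] L[of "C x"]
        by (simp only: CP)
      then show ?thesis by (simp add: bounded_clinear_imp[OF C(1)])
    qed
    then show "\<forall>C. bounded_clinear C \<longrightarrow> (\<forall>x. C (R x) = R (C x)) \<longrightarrow>
        (\<forall>x. C (x - L x) = C x - L (C x))"
      by blast
  qed
qed

end

section \<open>Positive operators, uniqueness of square roots, and the modulus\<close>

lemma positive_op_selfadjoint:
  assumes "positive_op P"
  shows "rinner (P x) y = rinner x (P y)" "0 \<le> rinner (P x) x"
proof -
  have P: "bounded_clinear P" and re: "\<And>x. cinner (P x) x \<in> \<real>\<^sub>\<ge>\<^sub>0"
    using assms by (auto simp: positive_op_def)
  note BP = bounded_clinear_imp[OF P]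
  show "0 \<le> rinner (P x) x" using re[of x] by (simp add: rinner_def complex_nonneg_Reals_iff)
  have im: "Im (cinner (P x) x) = 0" for x using re[of x] by (simp add: complex_nonneg_Reals_iff)
  \<comment> \<open>Polarisation of the real-valued form; replacing \<open>x\<close> by
    \<open>\<i> *\<^sub>C x\<close> then turns the statement on imaginary parts into symmetry of the
    real parts.\<close>
  have a: "Im (cinner (P x) y) + Im (cinner (P y) x) = 0" for x y
    using im[of "x + y"] im[of x] im[of y] by (simp add: BP cinner_add_left cinner_add_right)
  have "Re (cinner (P x) y) = Re (cinner (P y) x)"
    using a[of "\<i> *\<^sub>C x" y] by (simp add: BP cinner_scaleC_left cinner_scaleC_right)
  then show "rinner (P x) y = rinner x (P y)" by (simp add: rinner_def[symmetric] rinner_commute[of x])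
qed

lemma positive_opI:
  assumes S: "bounded_clinear S" "\<And>x y. rinner (S x) y = rinner x (S y)" "\<And>x. 0 \<le> rinner (S x) x"
  shows "positive_op S"
  unfolding positive_op_def complex_nonneg_Reals_iff
proof (intro conjI allI S)
  fix x
  show "0 \<le> Re (cinner (S x) x)" using S(3) by (simp add: rinner_def)
  \<comment> \<open>Up to sign this real part is the imaginary part in question, and
    self-adjointness makes it equal to its own negative.\<close>
  have "rinner (\<i> *\<^sub>C S x) x = rinner (\<i> *\<^sub>C x) (S x)"
    by (simp only: S(2) bounded_clinear_imp(2)[OF S(1), symmetric])
  also have "\<dots> = - rinner (\<i> *\<^sub>C S x) x"
    using cinner_commute[of x "S x"] by (simp add: rinner_def cinner_scaleC_left)
  finally show "Im (cinner (S x) x) = 0" by (simp add: rinner_def cinner_scaleC_left)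
qed

text \<open>Such a \<open>y\<close> minimises the form, so the first variation in the direction
  \<open>P y\<close>, which is twice \<open>(norm (P y))\<^sup>2\<close>, vanishes.\<close>

lemma positive_op_form_zero:
  assumes "positive_op P" "rinner (P y) y = 0"
  shows "P y = 0"
proof -
  have P: "bounded_clinear P" using assms(1) by (simp add: positive_op_def)
  note BP = bounded_clinear_imp[OF P] and sa = positive_op_selfadjoint[OF assms(1)]
  have "(norm (P y))\<^sup>2 = 0"
  proof (rule quadratic_nonneg_imp_zero)
    fix t :: real
    have "rinner (P (y + t *\<^sub>R P y)) (y + t *\<^sub>R P y) = 2 * t * (norm (P y))\<^sup>2 + t\<^sup>2 * rinner (P (P y)) (P y)"
      using assms(2) sa(1)[of "P y" y]
      by (simp add: BP rinner_simps rinner_self power2_eq_square algebra_simps)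
    then show "0 \<le> 2 * t * (norm (P y))\<^sup>2 + t\<^sup>2 * rinner (P (P y)) (P y)"
      using sa(2)[of "y + t *\<^sub>R P y"] by simp
  qed
  then show ?thesis by simp
qed

text \<open>For y = (P - X) x commutation gives (P + X) y = (P^2 - X^2) x = 0. Both forms are
  nonnegative, so both vanish at y, whence P y = X y = 0 and |y|^2 = <x, (P - X) y> = 0.\<close>

lemma positive_sqrt_unique:
  assumes P: "positive_op P" and X: "positive_op X" and sq: "\<And>x. P (P x) = X (X x)"
    and comm: "\<And>x. X (P x) = P (X x)"
  shows "P = X"
proof
  fix x
  note BP = bounded_clinear_imp[OF P[unfolded positive_op_def, THEN conjunct1]]
  note BX = bounded_clinear_imp[OF X[unfolded positive_op_def, THEN conjunct1]]
  define y where "y = P x - X x"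
  have "P y + X y = 0" by (simp add: y_def BP BX sq comm)
  then have "rinner (P y) y + rinner (X y) y = 0" by (metis rinner_add_left rinner_zero(1))
  then have "rinner (P y) y = 0" "rinner (X y) y = 0"
    using positive_op_selfadjoint(2)[OF P, of y] positive_op_selfadjoint(2)[OF X, of y] by linarith+
  then have "P y = 0" "X y = 0" using P X positive_op_form_zero by blast+
  moreover have "rinner y y = rinner x (P y) - rinner x (X y)"
    by (simp add: y_def rinner_diff_left positive_op_selfadjoint(1)[OF P] positive_op_selfadjoint(1)[OF X])
  ultimately have "rinner y y = 0" by simp
  then show "P x = X x" by (simp add: rinner_self y_def)
qed

text \<open>Scaling by a bound \<open>K\<close> of \<open>T\<close> makes R = 1 - T*T / K^2 a
  contraction, and \<open>K\<close> times the root of 1 - R is the modulus. Any other positive root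
  commutes with its own square T*T, hence with this one, so uniqueness applies.\<close>

lemma abs_op:
  fixes T :: "'a::complex_hilbert_space \<Rightarrow> 'b::complex_hilbert_space"
  assumes T: "bounded_clinear T"
  shows "positive_op (abs_op T)" "abs_op T (abs_op T x) = cadjoint T (T x)"
    "\<And>C x. bounded_clinear C \<Longrightarrow> (\<And>x. C (cadjoint T (T x)) = cadjoint T (T (C x))) \<Longrightarrow>
      C (abs_op T x) = abs_op T (C x)"
proof -
  define G where "G x = cadjoint T (T x)" for x
  note T' = cadjoint(1)[OF T] and ri = rinner_cadjoint[OF T]
  have G: "bounded_clinear G" unfolding G_def by (rule bounded_clinear_compose[OF T' T])
  have Gsa: "rinner (G x) y = rinner x (G y)" for x y unfolding G_def ri by (rule refl)
  obtain K where K: "K > 0" "\<And>x. norm (T x) \<le> norm x * K"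
    using bounded_linear.pos_bounded[OF bounded_clinear_imp(1)[OF T]] by blast
  then have K': "norm (cadjoint T y) \<le> K * norm y" for y
    by (intro cadjoint_norm_le[OF T]) (auto simp: mult.commute)
  define R where "R x = x - inverse (K\<^sup>2) *\<^sub>R G x" for x
  have R: "bounded_clinear R"
    unfolding R_def by (intro bounded_clinear_diff bounded_clinear_id bounded_clinear_scaleR G)
  \<comment> \<open>In the expanded square the last term is absorbed by the cross term, because
    \<open>norm (G x) \<le> K * norm (T x)\<close>.\<close>
  have Rn: "norm (R x) \<le> norm x" for x
  proof -
    have GT: "rinner x (G x) = (norm (T x))\<^sup>2" by (simp add: G_def rinner_self flip: ri(1))
    have "(norm (G x))\<^sup>2 \<le> (K * norm (T x))\<^sup>2" unfolding G_def by (intro power_mono K') simp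
    then have "inverse (K\<^sup>2) * (norm (G x))\<^sup>2 \<le> (norm (T x))\<^sup>2"
      using K(1) by (simp add: power_mult_distrib field_simps)
    then have "inverse (K\<^sup>2) * (inverse (K\<^sup>2) * (norm (G x))\<^sup>2) \<le> inverse (K\<^sup>2) * (norm (T x))\<^sup>2"
      by (rule mult_left_mono) simp
    moreover have "(norm (R x))\<^sup>2 = (norm x)\<^sup>2 - 2 * (inverse (K\<^sup>2) * (norm (T x))\<^sup>2)
        + inverse (K\<^sup>2) * (inverse (K\<^sup>2) * (norm (G x))\<^sup>2)"
      unfolding R_def norm_diff_sq rinner_scaleR_right GT norm_scaleR power_mult_distrib
      by (simp add: power2_eq_square)
    moreover have "0 \<le> inverse (K\<^sup>2) * (norm (T x))\<^sup>2" by simp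
    ultimately have "(norm (R x))\<^sup>2 \<le> (norm x)\<^sup>2" by linarith
    then show ?thesis by (rule power2_le_imp_le) simp
  qed
  have Rsa: "rinner (R x) y = rinner x (R y)" for x y by (simp add: R_def rinner_simps Gsa)
  obtain S where S: "bounded_clinear S" "\<And>x. S (S x) = x - R x"
      "\<And>x y. rinner (S x) y = rinner x (S y)" "\<And>x. 0 \<le> rinner (S x) x"
    and SC: "\<forall>C. bounded_clinear C \<longrightarrow> (\<forall>x. C (R x) = R (C x)) \<longrightarrow> (\<forall>x. C (S x) = S (C x))"
    by (rule one_minus_has_sqrt[OF R Rn Rsa]) (rule that)
  define P where "P x = K *\<^sub>R S x" for x
  have Pp: "positive_op P"
    unfolding P_def using K(1) S by (intro positive_opI bounded_clinear_scaleR) auto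
  have "K * K * inverse (K\<^sup>2) = 1" using K(1) by (simp add: power2_eq_square field_simps)
  then have PP: "P (P x) = G x" for x
    by (simp add: P_def bounded_clinear_imp[OF S(1)] S(2) R_def mult.assoc)
  have PC: "C (P x) = P (C x)" if C: "bounded_clinear C" "\<And>x. C (G x) = G (C x)" for C x
  proof -
    have "C (R x) = R (C x)" for x by (simp add: R_def bounded_clinear_imp[OF C(1)] C(2))
    then have "C (S x) = S (C x)" using SC C(1) by blast
    then show ?thesis by (simp add: P_def bounded_clinear_imp[OF C(1)])
  qed
  have "abs_op T = P"
    unfolding abs_op_def sqrt_op_def
  proof (rule the_equality)
    show "positive_op P \<and> P \<circ> P = cadjoint T \<circ> T" using Pp PP by (auto simp: G_def)
    fix X assume X: "positive_op X \<and> X \<circ> X = cadjoint T \<circ> T"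
    then have XX: "X (X x) = G x" for x by (metis G_def comp_apply)
    then have "X (G x) = G (X x)" for x by metis
    then have "X (P x) = P (X x)" for x by (intro PC) (use X in \<open>auto simp: positive_op_def\<close>)
    then have "P = X" using X by (intro positive_sqrt_unique[OF Pp]) (simp_all add: PP XX)
    then show "X = P" ..
  qed
  then show "positive_op (abs_op T)" "abs_op T (abs_op T x) = cadjoint T (T x)"
    "\<And>C x. bounded_clinear C \<Longrightarrow> (\<And>x. C (cadjoint T (T x)) = cadjoint T (T (C x))) \<Longrightarrow>
      C (abs_op T x) = abs_op T (C x)"
    using Pp PP PC by (simp_all add: G_def)
qed

section \<open>The Taylor spectrum\<close>

text \<open>With \<open>N\<^sub>1 = A - z\<close> and \<open>N\<^sub>2 = B - w\<close>, the operator \<open>cnj z N\<^sub>1 + cnj w N\<^sub>2\<close> is invertible and commutes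
  with \<open>N\<^sub>1\<close> and \<open>N\<^sub>2\<close>, so it provides a contracting homotopy of the Koszul complex.\<close>

lemma koszul_exactI:
  fixes A B :: "'a::complex_hilbert_space \<Rightarrow> 'a"
  assumes A: "bounded_clinear A" and B: "bounded_clinear B" and comm: "\<And>x. A (B x) = B (A x)"
    and norm: "\<And>x. norm (cnj z *\<^sub>C A x + cnj w *\<^sub>C B x) \<le> c * norm x"
    and c: "0 \<le> c" "c < (cmod z)\<^sup>2 + (cmod w)\<^sup>2"
  shows "koszul_exact (\<lambda>x. A x - z *\<^sub>C x) (\<lambda>x. B x - w *\<^sub>C x)"
proof -
  define r where "r = (cmod z)\<^sup>2 + (cmod w)\<^sup>2"
  define N1 where "N1 x = A x - z *\<^sub>C x" for x
  define N2 where "N2 x = B x - w *\<^sub>C x" for x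
  define L where "L x = cnj z *\<^sub>C A x + cnj w *\<^sub>C B x" for x
  define M where "M x = cnj z *\<^sub>C N1 x + cnj w *\<^sub>C N2 x" for x
  have r: "r > 0" "c < r" using c by (simp_all add: r_def)
  have bL: "bounded_clinear L"
    unfolding L_def
    by (intro bounded_clinear_add bounded_clinear_compose[OF bounded_clinear_scaleC A]
        bounded_clinear_compose[OF bounded_clinear_scaleC B])
  have bN: "bounded_clinear N1" "bounded_clinear N2"
    unfolding N1_def N2_def by (intro bounded_clinear_diff A B bounded_clinear_scaleC)+
  note lin = bounded_clinear_imp[OF A] bounded_clinear_imp[OF B]
  note N1 = bounded_clinear_imp[OF bN(1)] and N2 = bounded_clinear_imp[OF bN(2)]
  have NN: "N1 (N2 x) = N2 (N1 x)" for x
    unfolding N1_def N2_def by (simp add: lin comm scaleC_diff_right scaleC_scaleC mult.commute)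
  have "cnj z * z + cnj w * w = complex_of_real r"
    unfolding r_def of_real_add complex_norm_square by (simp add: mult.commute)
  moreover have "M x = L x - (cnj z * z + cnj w * w) *\<^sub>C x" for x
    by (simp add: M_def L_def N1_def N2_def scaleC_diff_right scaleC_scaleC scaleC_add_left)
  ultimately have M_eq: "M x = L x - r *\<^sub>R x" for x by (simp only: scaleC_of_real)
  have MN1: "M (N1 x) = N1 (M x)" and MN2: "M (N2 x) = N2 (M x)" for x
    by (simp_all add: M_def N1 N2 NN)
  have bij: "\<exists>!x. M x = y" for y
  proof -
    \<comment> \<open>\<open>M x = y\<close> is rewritten as a fixed point equation for a map with
      Lipschitz constant \<open>c / r\<close>.\<close>
    have "\<exists>!x. (1 / r) *\<^sub>R (L x - y) = x"
    proof (rule banach_fix_type[of "c / r"])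
      show "0 \<le> c / r" "c / r < 1" using c(1) r by simp_all
      show "\<forall>x x'. dist ((1 / r) *\<^sub>R (L x - y)) ((1 / r) *\<^sub>R (L x' - y)) \<le> c / r * dist x x'"
      proof (intro allI)
        fix x x'
        have "(1 / r) *\<^sub>R (L x - y) - (1 / r) *\<^sub>R (L x' - y) = (1 / r) *\<^sub>R L (x - x')"
          by (simp add: bounded_clinear_imp[OF bL] flip: scaleR_diff_right)
        moreover have "norm (L (x - x')) \<le> c * norm (x - x')" unfolding L_def by (rule norm)
        ultimately show "dist ((1 / r) *\<^sub>R (L x - y)) ((1 / r) *\<^sub>R (L x' - y)) \<le> c / r * dist x x'"
          using r(1) by (simp add: dist_norm divide_right_mono)
      qed
    qed
    moreover have "(1 / r) *\<^sub>R (L x - y) = x \<longleftrightarrow> M x = y" for x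
    proof -
      have "(1 / r) *\<^sub>R (L x - y) = x \<longleftrightarrow> L x - y = r *\<^sub>R x"
        using r(1) by (metis divideR_right inverse_eq_divide less_irrefl)
      then show ?thesis unfolding M_eq by (auto simp: algebra_simps)
    qed
    ultimately show ?thesis by simp
  qed
  then have inj: "x = y" if "M x = M y" for x y using that by blast
  have "koszul_exact N1 N2"
    unfolding koszul_exact_def
  proof (intro conjI)
    have "x = 0" if "N1 x = 0" "N2 x = 0" for x
      by (rule inj) (use that in \<open>simp add: M_def N1 N2\<close>)
    then show "{x. koszul0 N1 N2 x = 0} = {0}"
      by (auto simp: koszul0_def zero_prod_def N1 N2)
    have "(u, v) \<in> range (koszul0 N1 N2)" if uv: "N1 v = N2 u" for u v
    proof -
      \<comment> \<open>The homotopy applied to \<open>(u, v)\<close>. After applying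
        \<open>M\<close>, both required equations reduce to the cycle condition
        \<open>uv\<close>.\<close>
      obtain x where x: "M x = cnj z *\<^sub>C u + cnj w *\<^sub>C v" using bij by blast
      have "N1 x = u" by (rule inj) (unfold MN1 x, simp add: N1 uv M_def)
      moreover have "N2 x = v" by (rule inj) (unfold MN2 x, simp add: N2 uv[symmetric] M_def)
      ultimately show ?thesis by (auto simp: koszul0_def intro: range_eqI[of _ _ x])
    qed
    then show "range (koszul0 N1 N2) = {p. koszul1 N1 N2 p = 0}"
      by (auto simp: koszul0_def koszul1_def NN)
    have "y \<in> range (koszul1 N1 N2)" for y
    proof -
      obtain x where "M x = y" using bij by blast
      then have "koszul1 N1 N2 (- (cnj w *\<^sub>C x), cnj z *\<^sub>C x) = y"
        by (simp add: koszul1_def M_def N1 N2)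
      then show ?thesis by (metis rangeI)
    qed
    then show "range (koszul1 N1 N2) = UNIV" by auto
  qed
  then show ?thesis unfolding N1_def N2_def .
qed

lemma taylor_spectrum_bound:
  fixes A B :: "'a::complex_hilbert_space \<Rightarrow> 'a"
  assumes A: "bounded_clinear A" and B: "bounded_clinear B" and comm: "\<And>x. A (B x) = B (A x)"
    and bound: "\<And>x. (norm (A x))\<^sup>2 + (norm (B x))\<^sup>2 \<le> k * (norm x)\<^sup>2" and k: "0 \<le> k"
    and zw: "(z, w) \<in> taylor_spectrum A B"
  shows "(cmod z)\<^sup>2 + (cmod w)\<^sup>2 \<le> k"
proof (rule ccontr)
  assume "\<not> ?thesis"
  then have less: "k < (cmod z)\<^sup>2 + (cmod w)\<^sup>2" by simp
  define s where "s = sqrt ((cmod z)\<^sup>2 + (cmod w)\<^sup>2)"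
  have s: "s * s = (cmod z)\<^sup>2 + (cmod w)\<^sup>2" "s > 0" using less k by (simp_all add: s_def)
  have "koszul_exact (\<lambda>x. A x - z *\<^sub>C x) (\<lambda>x. B x - w *\<^sub>C x)"
  \<comment> \<open>The constant comes from Cauchy-Schwarz in the plane for
    \<open>(cmod z, cmod w)\<close> and \<open>(norm (A x), norm (B x))\<close>; it lies below
    \<open>s * s\<close> because \<open>sqrt k < s\<close>.\<close>
  proof (rule koszul_exactI[OF A B comm, where c = "s * sqrt k"])
    fix x
    have "norm (cnj z *\<^sub>C A x + cnj w *\<^sub>C B x) \<le> cmod z * norm (A x) + cmod w * norm (B x)"
      using norm_triangle_ineq[of "cnj z *\<^sub>C A x" "cnj w *\<^sub>C B x"] by (simp add: norm_scaleC)
    also have "\<dots> = inner (cmod z, cmod w) (norm (A x), norm (B x))" by simp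
    also have "\<dots> \<le> norm (cmod z, cmod w) * norm (norm (A x), norm (B x))" by (rule norm_cauchy_schwarz)
    also have "\<dots> = s * sqrt ((norm (A x))\<^sup>2 + (norm (B x))\<^sup>2)" by (simp add: norm_prod_def s_def)
    also have "\<dots> \<le> s * sqrt (k * (norm x)\<^sup>2)" using bound[of x] s(2) by (simp add: mult_left_mono)
    also have "\<dots> = s * sqrt k * norm x" by (simp add: real_sqrt_mult)
    finally show "norm (cnj z *\<^sub>C A x + cnj w *\<^sub>C B x) \<le> s * sqrt k * norm x" .
    show "0 \<le> s * sqrt k" using k s(2) by simp
    have "sqrt k < s" using less by (simp add: s_def)
    then show "s * sqrt k < (cmod z)\<^sup>2 + (cmod w)\<^sup>2" using s by (simp flip: s(1))
  qed
  then show False using zw by (simp add: taylor_spectrum_def)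
qed

text \<open>The uniform boundedness argument: pairing \<open>y = N\<^sub>1 v - N\<^sub>2 u\<close> with \<open>x\<close> is controlled by \<open>N\<^sub>1 x\<close> and
  \<open>N\<^sub>2 x\<close>, with a constant that Baire's theorem makes uniform in \<open>y\<close>.\<close>

lemma surj_koszul1_bounded_below:
  fixes N1 N2 :: "'a::complex_hilbert_space \<Rightarrow> 'a"
  assumes sa: "\<And>x y. rinner (N1 x) y = rinner x (N1 y)" "\<And>x y. rinner (N2 x) y = rinner x (N2 y)"
    and surj: "range (koszul1 N1 N2) = UNIV"
  shows "\<exists>c>0. \<forall>x. c * norm x \<le> norm (N1 x) + norm (N2 x)"
proof -
  define n where "n x = norm (N1 x) + norm (N2 x)" for x
  have n: "n x \<ge> 0" for x by (simp add: n_def)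
  define F where "F k = {y. \<forall>x. \<bar>rinner y x\<bar> \<le> real k * n x}" for k :: nat
  have closed: "closed (F k)" for k
  proof -
    have "F k = (\<Inter>x. {y. \<bar>rinner y x\<bar> \<le> real k * n x})" by (auto simp: F_def)
    moreover have "closed {y. \<bar>rinner y x\<bar> \<le> real k * n x}" for x
      by (intro closed_Collect_le continuous_intros linear_continuous_on bounded_linear_rinner_left)
    ultimately show ?thesis by (auto intro: closed_INT)
  qed
  have "\<exists>k. y \<in> F k" for y
  proof -
    obtain p where "y = koszul1 N1 N2 p" using surj by blast
    then obtain u v where y: "y = N1 v - N2 u" by (simp add: koszul1_def)
    obtain k where k: "norm u + norm v \<le> real k" using real_arch_simple by blast
    have "\<bar>rinner y x\<bar> \<le> real k * n x" for x
    proof -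
      have "\<bar>rinner y x\<bar> \<le> \<bar>rinner v (N1 x)\<bar> + \<bar>rinner u (N2 x)\<bar>"
        by (simp add: y rinner_simps sa)
      also have "\<dots> \<le> norm v * norm (N1 x) + norm u * norm (N2 x)" by (intro add_mono rinner_le_norm)
      also have "\<dots> \<le> real k * norm (N1 x) + real k * norm (N2 x)"
        using k by (intro add_mono mult_right_mono) (auto intro: order_trans[rotated])
      finally show ?thesis by (simp add: n_def distrib_left)
    qed
    then show ?thesis by (auto simp: F_def)
  qed
  then have "\<Union> (range F) = UNIV" by auto
  then have "\<exists>k. interior (F k) \<noteq> {}"
    using Baire_category_alt[of "euclidean :: 'a topology" "range F"] closed
    by (auto simp: completely_metrizable_space_euclidean) fastforce
  then obtain k y where "y \<in> interior (F k)" by blast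
  then obtain r where r: "r > 0" "cball y r \<subseteq> F k" using mem_interior_cball by blast
  have main: "r * norm x \<le> 2 * real k * n x" for x
  proof (cases "x = 0")
    case False
    \<comment> \<open>The boundary point of the ball in direction \<open>x\<close>: its pairing with
      \<open>x\<close> exceeds that of \<open>y\<close> by \<open>r * norm x\<close>, while both
      pairings are bounded by \<open>real k * n x\<close>.\<close>
    define y' where "y' = y + (r / norm x) *\<^sub>R x"
    have "y' \<in> F k" "y \<in> F k" using r False by (auto simp: y'_def dist_norm intro!: subsetD[OF r(2)])
    then have "\<bar>rinner y' x\<bar> \<le> real k * n x" "\<bar>rinner y x\<bar> \<le> real k * n x" by (auto simp: F_def)
    moreover have "rinner y' x = rinner y x + r * norm x"
      using False by (simp add: y'_def rinner_simps rinner_self power2_eq_square)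
    ultimately show ?thesis by linarith
  qed (simp add: n)
  show ?thesis
  proof (intro exI conjI allI)
    \<comment> \<open>The summand 1 covers the case \<open>k = 0\<close>.\<close>
    show "r / (2 * real k + 1) > 0" using r by (simp add: add_nonneg_pos)
    fix x
    have "r * norm x \<le> (2 * real k + 1) * n x" using main[of x] n[of x] by (simp add: distrib_right)
    then show "r / (2 * real k + 1) * norm x \<le> norm (N1 x) + norm (N2 x)"
      unfolding n_def[symmetric] by (simp add: pos_divide_le_eq add_nonneg_pos mult.commute)
  qed
qed

lemma approx_eigenvector_in_taylor_spectrum:
  fixes A B :: "'a::complex_hilbert_space \<Rightarrow> 'a"
  assumes sa: "\<And>x y. rinner (A x) y = rinner x (A y)" "\<And>x y. rinner (B x) y = rinner x (B y)"
    and ev: "\<And>e. e > 0 \<Longrightarrow> \<exists>x. norm x = 1 \<and> norm (A x - a *\<^sub>R x) \<le> e \<and> norm (B x - b *\<^sub>R x) \<le> e"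
  shows "(complex_of_real a, complex_of_real b) \<in> taylor_spectrum A B"
proof -
  let ?A = "\<lambda>x. A x - complex_of_real a *\<^sub>C x" and ?B = "\<lambda>x. B x - complex_of_real b *\<^sub>C x"
  have "\<not> koszul_exact ?A ?B"
  proof
    assume "koszul_exact ?A ?B"
    then have surj: "range (koszul1 ?A ?B) = UNIV" by (simp add: koszul_exact_def)
    obtain c where c: "c > 0" "\<And>x. c * norm x \<le> norm (?A x) + norm (?B x)"
      using surj_koszul1_bounded_below[OF _ _ surj] sa by (auto simp: rinner_simps scaleC_of_real)
    obtain x where "norm x = 1" "norm (A x - a *\<^sub>R x) \<le> c / 3" "norm (B x - b *\<^sub>R x) \<le> c / 3"
      using ev[of "c / 3"] c(1) by auto
    then show False using c(1) c(2)[of x] by (simp add: scaleC_of_real)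
  qed
  then show ?thesis by (simp add: taylor_spectrum_def)
qed

section \<open>Joint approximate eigenvectors of commuting self-adjoint operators\<close>

text \<open>The functional \<open>p\<close> measures the distance to a subspace invariant under \<open>A\<close>, and \<open>\<alpha>\<close> is the
  supremum of the quadratic form of \<open>A\<close> on vectors asymptotically in that subspace.\<close>

lemma approx_eigenvector_exists:
  fixes A :: "'a::complex_hilbert_space \<Rightarrow> 'a"
  assumes A: "bounded_linear A" and sa: "\<And>x y. rinner (A x) y = rinner x (A y)"
    and p_nonneg: "\<And>x. 0 \<le> p x" and p_add: "\<And>x y. p (x + y) \<le> p x + p y"
    and p_scale: "\<And>r x. p (r *\<^sub>R x) = \<bar>r\<bar> * p x" and p_A: "\<And>x. p (A x) \<le> K * p x" and K: "0 \<le> K"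
    and ex: "\<And>e::real. e > 0 \<Longrightarrow> \<exists>x. norm x = 1 \<and> p x \<le> e"
  obtains \<alpha> where "\<forall>e>0. \<exists>x. norm x = 1 \<and> p x \<le> e \<and> norm (A x - \<alpha> *\<^sub>R x) \<le> e"
    "\<forall>d>0. \<exists>e>0. \<forall>x. norm x = 1 \<longrightarrow> p x \<le> e \<longrightarrow> rinner (A x) x \<le> \<alpha> + d"
proof -
  interpret A: bounded_linear A by fact
  obtain C where C: "C \<ge> 0" "\<And>x. norm (A x) \<le> norm x * C" using A.nonneg_bounded by blast
  define W where "W e = {rinner (A x) x | x. norm x = 1 \<and> p x \<le> e}" for e
  have W_bd: "\<bar>t\<bar> \<le> C" if "t \<in> W e" for t e
  proof -
    obtain x where x: "norm x = 1" "t = rinner (A x) x" using \<open>t \<in> W e\<close> by (auto simp: W_def)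
    show ?thesis using rinner_le_norm[of "A x" x] C(2)[of x] x by simp
  qed
  have W_ne: "W e \<noteq> {}" if "e > 0" for e using ex[OF that] by (auto simp: W_def)
  have W_ba: "bdd_above (W e)" for e using W_bd abs_le_D1 by (meson bdd_aboveI)
  have sup_lb: "- C \<le> Sup (W e)" if e: "e > 0" for e
  proof -
    obtain t where "t \<in> W e" using W_ne[OF e] by blast
    then show ?thesis using cSup_upper[OF _ W_ba, of t e] W_bd[of t e] by linarith
  qed
  \<comment> \<open>\<open>Sup (W e)\<close> is monotone in \<open>e\<close>, so this infimum is its
    limit as \<open>e\<close> tends to 0.\<close>
  define \<alpha> where "\<alpha> = Inf ((\<lambda>e. Sup (W e)) ` {0<..})"
  have \<alpha>_le: "\<alpha> \<le> Sup (W e)" if "e > 0" for e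
    unfolding \<alpha>_def using sup_lb that by (intro cInf_lower) (auto intro!: bdd_belowI2[where m = "- C"])
  have near: "\<exists>x. norm x = 1 \<and> p x \<le> e \<and> \<alpha> - d < rinner (A x) x" if e: "e > 0" and d: "d > 0" for e d
  proof -
    have "\<alpha> - d < Sup (W e)" using \<alpha>_le[OF e] d by linarith
    then obtain t where "t \<in> W e" "\<alpha> - d < t" using less_cSupD[OF W_ne[OF e]] by blast
    then show ?thesis by (auto simp: W_def)
  qed
  have upper: "\<exists>e>0. \<forall>x. norm x = 1 \<longrightarrow> p x \<le> e \<longrightarrow> rinner (A x) x \<le> \<alpha> + d" if "d > 0" for d
  proof -
    have "Inf ((\<lambda>e. Sup (W e)) ` {0<..}) < \<alpha> + d" using that by (simp add: \<alpha>_def)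
    then obtain e where e: "e > 0" "Sup (W e) < \<alpha> + d"
      using cInf_lessD[of "(\<lambda>e. Sup (W e)) ` {0<..}"] by (auto simp: greaterThan_non_empty)
    have "rinner (A x) x \<le> \<alpha> + d" if "norm x = 1" "p x \<le> e" for x
    proof -
      have "rinner (A x) x \<le> Sup (W e)" by (rule cSup_upper[OF _ W_ba]) (use that in \<open>auto simp: W_def\<close>)
      with e show ?thesis by linarith
    qed
    with e show ?thesis by blast
  qed
  have "\<exists>x. norm x = 1 \<and> p x \<le> e \<and> norm (A x - \<alpha> *\<^sub>R x) \<le> e" if e: "e > 0" for e
  proof -
    \<comment> \<open>An approximate version of \<open>positive_op_form_zero\<close>. Below,
      \<open>P\<close> is \<alpha> + t^2 - A: its form is nonnegative on vectors with small
      \<open>p\<close>, and less than 2 t^2 at a near-maximiser \<open>x\<close>. Testing it at u =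
      x - t P x gives |P x|^2 \<le> t (1 + D^3); the slack is of order t^2 so that a factor t
      survives the division by 2 t. \<open>D\<close> bounds the norm of \<open>P\<close>, and
      \<open>K'\<close> its effect on \<open>p\<close>.\<close>
    define D where "D = C + \<bar>\<alpha>\<bar> + 1"
    define K' where "K' = K + \<bar>\<alpha>\<bar> + 1"
    have D: "D \<ge> 1" and K': "K' \<ge> 1" using C(1) K by (simp_all add: D_def K'_def)
    \<comment> \<open>The bounds serve, in order, \<open>\<bar>\<alpha> + t\<^sup>2\<bar> \<le>
      \<bar>\<alpha>\<bar> + 1\<close>, \<open>norm u \<ge> 1 / 2\<close>,
      \<open>norm (P x) \<le> e / 2\<close>, and the remaining error
      \<open>t\<^sup>2 \<le> e / 2\<close>.\<close>
    define t where "t = min (min 1 (1 / (2 * D))) (min ((e / 2)\<^sup>2 / (1 + D ^ 3)) (e / 2))"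
    have D3: "1 + D ^ 3 > 0" using D by (simp add: add_pos_nonneg)
    have "t \<le> 1 / (2 * D)" "t \<le> (e / 2)\<^sup>2 / (1 + D ^ 3)" by (simp_all add: t_def)
    then have "t * (2 * D) \<le> 1" "t * (1 + D ^ 3) \<le> (e / 2)\<^sup>2"
      using D D3 by (simp_all add: pos_le_divide_eq del: power_divide)
    moreover have "t > 0" "t \<le> 1" "t \<le> e / 2" using e D D3 unfolding t_def by (simp_all only: min_less_iff_conj min.coboundedI1 min.coboundedI2 order_refl) simp
    ultimately have t: "t > 0" "t \<le> 1" "t * D \<le> 1 / 2" "t * (1 + D ^ 3) \<le> (e / 2)\<^sup>2" "t \<le> e / 2"
      by simp_all
    have tt: "t\<^sup>2 \<le> t" using t(1,2) by (simp add: power2_eq_square mult_left_le)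
    obtain e0 where e0: "e0 > 0" "\<And>x. norm x = 1 \<Longrightarrow> p x \<le> e0 \<Longrightarrow> rinner (A x) x \<le> \<alpha> + t\<^sup>2"
      using upper[of "t\<^sup>2"] t(1) by auto
    define P where "P x = (\<alpha> + t\<^sup>2) *\<^sub>R x - A x" for x
    have P_nonneg: "0 \<le> rinner (P u) u" if "p u \<le> e0 * norm u" for u
    proof (cases "u = 0")
      case False
      define v where "v = inverse (norm u) *\<^sub>R u"
      have v: "norm v = 1" "p v \<le> e0" "u = norm u *\<^sub>R v"
        using False that by (simp_all add: v_def p_scale divide_simps mult.commute)
      have "rinner (A u) u = (norm u)\<^sup>2 * rinner (A v) v"
        by (subst (1 2) v(3)) (simp add: A.scaleR power2_eq_square)
      also have "\<dots> \<le> (norm u)\<^sup>2 * (\<alpha> + t\<^sup>2)" using e0(2)[OF v(1,2)] by (simp add: mult_left_mono)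
      finally show ?thesis by (simp add: P_def rinner_simps rinner_self mult.commute)
    qed (simp add: P_def A.zero)
    have P_lin: "P (x - s *\<^sub>R y) = P x - s *\<^sub>R P y" for x y s
      by (simp add: P_def A.diff A.scaleR algebra_simps)
    have P_sa: "rinner (P x) y = rinner x (P y)" for x y by (simp add: P_def rinner_simps sa)
    have at: "\<bar>\<alpha> + t\<^sup>2\<bar> \<le> \<bar>\<alpha>\<bar> + 1" using t(2) tt zero_le_power2[of t] by linarith
    have P_norm: "norm (P x) \<le> D * norm x" for x
    proof -
      have "norm (P x) \<le> \<bar>\<alpha> + t\<^sup>2\<bar> * norm x + norm (A x)"
        unfolding P_def using norm_triangle_ineq4[of "(\<alpha> + t\<^sup>2) *\<^sub>R x" "A x"] by simp
      also have "\<dots> \<le> (\<bar>\<alpha>\<bar> + 1) * norm x + norm x * C" by (intro add_mono mult_right_mono at C) simp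
      finally show ?thesis by (simp add: D_def algebra_simps)
    qed
    have p_P: "p (P x) \<le> K' * p x" for x
    proof -
      have "p (P x) \<le> \<bar>\<alpha> + t\<^sup>2\<bar> * p x + p (A x)"
        using p_add[of "(\<alpha> + t\<^sup>2) *\<^sub>R x" "(-1) *\<^sub>R A x"] unfolding p_scale P_def by simp
      also have "\<dots> \<le> (\<bar>\<alpha>\<bar> + 1) * p x + K * p x" by (intro add_mono mult_right_mono at p_A p_nonneg)
      finally show ?thesis by (simp add: K'_def algebra_simps)
    qed
    \<comment> \<open>Chosen so that
      \<open>p u \<le> e1 * (1 + K') \<le> e0 / 2 \<le> e0 * norm u\<close>: the test vector stays
      where the form of \<open>P\<close> is nonnegative.\<close>
    define e1 where "e1 = min e (e0 / (2 * (1 + K')))"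
    have "e1 \<le> e0 / (2 * (1 + K'))" by (simp add: e1_def)
    then have "e1 * (2 * (1 + K')) \<le> e0" using K' by (simp add: pos_le_divide_eq)
    then have "e1 * (1 + K') \<le> e0 / 2" by (simp add: algebra_simps)
    moreover have "e1 > 0" "e1 \<le> e" using e e0(1) K' by (simp_all add: e1_def)
    ultimately have e1: "e1 * (1 + K') \<le> e0 / 2" "e1 > 0" "e1 \<le> e" by blast+
    obtain x where x: "norm x = 1" "p x \<le> e1" "\<alpha> - t\<^sup>2 < rinner (A x) x"
      using near[OF e1(2), of "t\<^sup>2"] t(1) by auto
    define y where "y = P x"
    have y: "norm y \<le> D" using P_norm[of x] x(1) by (simp add: y_def)
    define u where "u = x - t *\<^sub>R y"
    have "t * norm y \<le> t * D" using y t(1) by (intro mult_left_mono) simp_all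
    with t(3) have "t * norm y \<le> 1 / 2" by linarith
    then have "norm (t *\<^sub>R y) \<le> 1 / 2" using t(1) by simp
    then have u: "norm u \<ge> 1 / 2"
      unfolding u_def using norm_triangle_ineq2[of x "t *\<^sub>R y"] x(1) by simp
    have "p u \<le> p x + t * p y"
      unfolding u_def using p_add[of x "(- t) *\<^sub>R y"] t(1) by (simp add: p_scale del: scaleR_minus_left) simp
    also have "\<dots> \<le> p x + 1 * (K' * p x)"
      unfolding y_def using t(1,2) by (intro add_mono mult_mono p_P p_nonneg) simp_all
    also have "\<dots> \<le> e1 * (1 + K')"
      using mult_right_mono[OF x(2), of "1 + K'"] K' by (simp add: algebra_simps)
    also have "\<dots> \<le> e0 * norm u" using e1(1) mult_left_mono[OF u, of e0] e0(1) by linarith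
    finally have "0 \<le> rinner (P u) u" by (rule P_nonneg)
    also have "rinner (P u) u = rinner (P x) x - 2 * t * (norm y)\<^sup>2 + t\<^sup>2 * rinner (P y) y"
      using P_sa[of y x] unfolding u_def P_lin
      by (simp add: rinner_simps y_def[symmetric] rinner_self power2_eq_square algebra_simps)
    finally have 1: "2 * t * (norm y)\<^sup>2 \<le> rinner (P x) x + t\<^sup>2 * rinner (P y) y" by simp
    have 2: "rinner (P x) x \<le> 2 * t\<^sup>2" using x(1,3) by (simp add: P_def rinner_simps rinner_self)
    have "rinner (P y) y \<le> D * norm y * norm y"
      using rinner_le[of "P y" y] mult_right_mono[OF P_norm[of y], of "norm y"] by simp
    also have "\<dots> \<le> D * D * D" using D by (intro mult_mono y) auto
    finally have "t\<^sup>2 * rinner (P y) y \<le> t\<^sup>2 * D ^ 3"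
      by (simp add: power3_eq_cube mult_left_mono)
    with 1 2 have "2 * t * (norm y)\<^sup>2 \<le> 2 * t\<^sup>2 + t\<^sup>2 * D ^ 3" by linarith
    also have "\<dots> \<le> 2 * t\<^sup>2 + 2 * (t\<^sup>2 * D ^ 3)" using D by simp
    also have "\<dots> = 2 * t * (t * (1 + D ^ 3))" by (simp add: power2_eq_square algebra_simps)
    also have "\<dots> \<le> 2 * t * (e / 2)\<^sup>2" using t by (intro mult_left_mono) auto
    finally have "(norm y)\<^sup>2 \<le> (e / 2)\<^sup>2" using t(1) by simp
    then have "norm y \<le> e / 2" by (rule power2_le_imp_le) (use e in simp)
    moreover have "A x - \<alpha> *\<^sub>R x = t\<^sup>2 *\<^sub>R x - y" by (simp add: y_def P_def algebra_simps)
    then have "norm (A x - \<alpha> *\<^sub>R x) \<le> t\<^sup>2 + norm y"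
      using norm_triangle_ineq4[of "t\<^sup>2 *\<^sub>R x" y] x(1) by simp
    ultimately have "norm (A x - \<alpha> *\<^sub>R x) \<le> e" using tt t(5) by linarith
    then show ?thesis using x e1(3) by (intro exI[of _ x]) auto
  qed
  then show thesis using upper that by blast
qed

text \<open>The conditions already imposed are carried along as a functional: 0, then
  \<open>p\<close>, then \<open>q\<close>. Commutativity bounds its growth under the next operator,
  as the extraction of one more approximate eigenvalue requires. The sharp upper bound is that for
  the form of \<open>S\<close>.\<close>

lemma joint_approx_eigenvector:
  fixes A B :: "'a::complex_hilbert_space \<Rightarrow> 'a"
  assumes A: "bounded_linear A" and B: "bounded_linear B" and comm: "\<And>x. A (B x) = B (A x)"
    and sa: "\<And>x y. rinner (A x) y = rinner x (A y)" "\<And>x y. rinner (B x) y = rinner x (B y)"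
    and nontrivial: "(UNIV :: 'a set) \<noteq> {0}"
  obtains a b where
    "\<And>e. e > 0 \<Longrightarrow> \<exists>x. norm x = 1 \<and> norm (A x - a *\<^sub>R x) \<le> e \<and> norm (B x - b *\<^sub>R x) \<le> e"
    "\<And>x. (norm (A x))\<^sup>2 + (norm (B x))\<^sup>2 \<le> (a\<^sup>2 + b\<^sup>2) * (norm x)\<^sup>2"
proof -
  interpret A: bounded_linear A by fact
  interpret B: bounded_linear B by fact
  obtain C where C: "C \<ge> 0" "\<And>x. norm (A x) \<le> norm x * C" using A.nonneg_bounded by blast
  obtain C' where C': "C' \<ge> 0" "\<And>x. norm (B x) \<le> norm x * C'" using B.nonneg_bounded by blast
  define S where "S x = A (A x) + B (B x)" for x
  have S: "bounded_linear S"
    unfolding S_def by (intro bounded_linear_add bounded_linear_compose[OF A A] bounded_linear_compose[OF B B])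
  interpret S: bounded_linear S by fact
  have SA: "S (A x) = A (S x)" and SB: "S (B x) = B (S x)" for x
    by (simp_all add: S_def A.add B.add comm)
  have S_sa: "rinner (S x) y = rinner x (S y)" for x y by (simp add: S_def rinner_simps sa)
  obtain x0 :: 'a where "x0 \<noteq> 0" using nontrivial by blast
  then have unit: "\<exists>x::'a. norm x = 1" by (intro exI[of _ "sgn x0"]) (simp add: norm_sgn)
  \<comment> \<open>With \<open>p\<close> zero the constraint is vacuous, and \<open>m\<close> is
    the supremum of the form of \<open>S\<close> on the unit sphere.\<close>
  obtain m where m: "\<forall>e>0. \<exists>x. norm x = 1 \<and> 0 \<le> e \<and> norm (S x - m *\<^sub>R x) \<le> e"
    and m_up: "\<forall>d>0. \<exists>e>0::real. \<forall>x. norm x = 1 \<longrightarrow> 0 \<le> e \<longrightarrow> rinner (S x) x \<le> m + d"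
    by (rule approx_eigenvector_exists[OF S S_sa, where p = "\<lambda>_. 0" and K = 0],
        simp, simp, simp, simp, simp, use unit in force) (rule that)
  define p where "p x = norm (S x - m *\<^sub>R x)" for x
  have p: "0 \<le> p x" "p (x + y) \<le> p x + p y" "p (r *\<^sub>R x) = \<bar>r\<bar> * p x" for x y r
  proof -
    show "0 \<le> p x" by (simp add: p_def)
    have "S (x + y) - m *\<^sub>R (x + y) = (S x - m *\<^sub>R x) + (S y - m *\<^sub>R y)"
      by (simp add: S.add algebra_simps)
    then show "p (x + y) \<le> p x + p y" unfolding p_def by (simp only: norm_triangle_ineq)
    have "S (r *\<^sub>R x) - m *\<^sub>R (r *\<^sub>R x) = r *\<^sub>R (S x - m *\<^sub>R x)"
      by (simp add: S.scaleR algebra_simps)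
    then show "p (r *\<^sub>R x) = \<bar>r\<bar> * p x" unfolding p_def by (simp only: norm_scaleR)
  qed
  have p_A: "p (A x) \<le> C * p x" and p_B: "p (B x) \<le> C' * p x" for x
    using C(2)[of "S x - m *\<^sub>R x"] C'(2)[of "S x - m *\<^sub>R x"]
    by (simp_all add: p_def SA SB A.diff A.scaleR B.diff B.scaleR mult.commute)
  obtain a where a: "\<forall>e>0. \<exists>x. norm x = 1 \<and> p x \<le> e \<and> norm (A x - a *\<^sub>R x) \<le> e"
    by (rule approx_eigenvector_exists[OF A sa(1) p p_A C(1)], use m in \<open>force simp: p_def\<close>) (rule that)
  define q where "q x = p x + norm (A x - a *\<^sub>R x)" for x
  have q: "0 \<le> q x" "q (x + y) \<le> q x + q y" "q (r *\<^sub>R x) = \<bar>r\<bar> * q x" for x y r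
  proof -
    show "0 \<le> q x" by (simp add: q_def p)
    have "A (x + y) - a *\<^sub>R (x + y) = (A x - a *\<^sub>R x) + (A y - a *\<^sub>R y)"
      by (simp add: A.add algebra_simps)
    then show "q (x + y) \<le> q x + q y"
      unfolding q_def using p(2)[of x y] norm_triangle_ineq[of "A x - a *\<^sub>R x" "A y - a *\<^sub>R y"] by simp
    have "A (r *\<^sub>R x) - a *\<^sub>R (r *\<^sub>R x) = r *\<^sub>R (A x - a *\<^sub>R x)"
      by (simp add: A.scaleR algebra_simps)
    then show "q (r *\<^sub>R x) = \<bar>r\<bar> * q x" by (simp add: q_def p distrib_left)
  qed
  have q_B: "q (B x) \<le> C' * q x" for x
  proof -
    have "norm (A (B x) - a *\<^sub>R B x) \<le> C' * norm (A x - a *\<^sub>R x)"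
      using C'(2)[of "A x - a *\<^sub>R x"] by (simp add: comm B.diff B.scaleR mult.commute)
    then show ?thesis using p_B[of x] by (simp add: q_def distrib_left)
  qed
  have q_ex: "\<exists>x. norm x = 1 \<and> q x \<le> e" if "e > 0" for e
    using a[rule_format, of "e / 2"] that by (auto simp: q_def)
  obtain b where b: "\<forall>e>0. \<exists>x. norm x = 1 \<and> q x \<le> e \<and> norm (B x - b *\<^sub>R x) \<le> e"
    by (rule approx_eigenvector_exists[OF B sa(2) q q_B C'(1) q_ex], assumption) (rule that)
  have ab: "\<exists>x. norm x = 1 \<and> norm (S x - m *\<^sub>R x) \<le> e \<and> norm (A x - a *\<^sub>R x) \<le> e \<and> norm (B x - b *\<^sub>R x) \<le> e"
    if e: "e > 0" for e
  proof -
    obtain x where x: "norm x = 1" "q x \<le> e" "norm (B x - b *\<^sub>R x) \<le> e" using b e by blast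
    have "norm (S x - m *\<^sub>R x) \<le> e" "norm (A x - a *\<^sub>R x) \<le> e"
      using x(2) norm_ge_zero[of "S x - m *\<^sub>R x"] norm_ge_zero[of "A x - a *\<^sub>R x"]
      unfolding q_def p_def by linarith+
    with x show ?thesis by blast
  qed
  have m_eq: "m = a\<^sup>2 + b\<^sup>2"
  proof -
    \<comment> \<open>Substituting A x = a x + f and B x = b x + g in S x - m x leaves an error of
      at most \<open>k\<close> times the common bound \<open>e / k\<close> for the three
      residuals.\<close>
    define k where "k = 1 + (C + \<bar>a\<bar>) + (C' + \<bar>b\<bar>)"
    have k: "k > 0" using C(1) C'(1) by (simp add: k_def)
    have "\<bar>m - a\<^sup>2 - b\<^sup>2\<bar> \<le> 0 + e" if e: "e > 0" for e
    proof -
      obtain x where x: "norm x = 1" "norm (S x - m *\<^sub>R x) \<le> e / k" "norm (A x - a *\<^sub>R x) \<le> e / k"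
        "norm (B x - b *\<^sub>R x) \<le> e / k"
        using ab[of "e / k"] e k by auto
      define f where "f = A x - a *\<^sub>R x"
      define g where "g = B x - b *\<^sub>R x"
      have Ax: "A x = f + a *\<^sub>R x" and Bx: "B x = g + b *\<^sub>R x" by (simp_all add: f_def g_def)
      have "A (A x) = A f + a *\<^sub>R f + (a * a) *\<^sub>R x"
        by (subst Ax) (simp add: A.add A.scaleR, simp add: Ax scaleR_add_right)
      moreover have "B (B x) = B g + b *\<^sub>R g + (b * b) *\<^sub>R x"
        by (subst Bx) (simp add: B.add B.scaleR, simp add: Bx scaleR_add_right)
      ultimately have "(m - a\<^sup>2 - b\<^sup>2) *\<^sub>R x = (A f + a *\<^sub>R f) + (B g + b *\<^sub>R g) - (S x - m *\<^sub>R x)"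
        by (simp add: S_def power2_eq_square algebra_simps)
      then have "\<bar>m - a\<^sup>2 - b\<^sup>2\<bar> = norm ((A f + a *\<^sub>R f) + (B g + b *\<^sub>R g) - (S x - m *\<^sub>R x))"
        using x(1) by (metis mult.right_neutral norm_scaleR)
      also have "\<dots> \<le> (norm (A f) + \<bar>a\<bar> * norm f) + (norm (B g) + \<bar>b\<bar> * norm g) + norm (S x - m *\<^sub>R x)"
        unfolding norm_scaleR[symmetric]
        by (intro order_trans[OF norm_triangle_ineq4] order_trans[OF norm_triangle_ineq] add_mono
            norm_triangle_ineq order_refl)
      also have "\<dots> \<le> (e / k * C + \<bar>a\<bar> * (e / k)) + (e / k * C' + \<bar>b\<bar> * (e / k)) + e / k"
        using x(3,4) unfolding f_def[symmetric] g_def[symmetric]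
        by (intro add_mono x(2) mult_left_mono order_trans[OF C(2)] order_trans[OF C'(2)] mult_right_mono C C')
          simp_all
      also have "\<dots> = e / k * (1 + (C + \<bar>a\<bar>) + (C' + \<bar>b\<bar>))" by (simp only: distrib_left mult_ac mult_1_right mult_1_left add_ac)
      also have "\<dots> = e / k * k" by (simp only: k_def)
      finally show ?thesis using k by simp
    qed
    then have "\<bar>m - a\<^sup>2 - b\<^sup>2\<bar> \<le> 0" by (rule field_le_epsilon)
    then show ?thesis by simp
  qed
  show thesis
  proof
    show "\<exists>x. norm x = 1 \<and> norm (A x - a *\<^sub>R x) \<le> e \<and> norm (B x - b *\<^sub>R x) \<le> e" if "e > 0" for e
      using ab[OF that] by blast
    fix x
    have eq: "(norm (A x))\<^sup>2 + (norm (B x))\<^sup>2 = rinner (S x) x" for x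
      by (simp add: S_def rinner_simps sa rinner_self)
    show "(norm (A x))\<^sup>2 + (norm (B x))\<^sup>2 \<le> (a\<^sup>2 + b\<^sup>2) * (norm x)\<^sup>2"
    proof (cases "x = 0")
      case False
      define y where "y = inverse (norm x) *\<^sub>R x"
      have y: "norm y = 1" "x = norm x *\<^sub>R y" using False by (simp_all add: y_def)
      have "rinner (S y) y \<le> m"
        by (rule field_le_epsilon) (use m_up y(1) in \<open>meson less_imp_le\<close>)
      then have "(norm x)\<^sup>2 * rinner (S y) y \<le> (norm x)\<^sup>2 * m" by (rule mult_left_mono) simp
      moreover have "rinner (S x) x = (norm x)\<^sup>2 * rinner (S y) y"
        by (subst (1 2) y(2)) (simp add: S.scaleR power2_eq_square)
      ultimately show ?thesis by (simp add: eq m_eq mult.commute)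
    qed (simp add: A.zero B.zero)
  qed
qed

text \<open>Identifies the radius with the norm of the column operator x -> (A x, B x). The
  \<open>GREATEST\<close> is attained at the joint approximate eigenvalue \<open>(a, b)\<close>,
  whose modulus squared is also an upper bound of the form and so dominates the whole
  spectrum.\<close>

lemma geometric_spectral_radius_selfadjoint:
  fixes A B :: "'a::complex_hilbert_space \<Rightarrow> 'a"
  assumes A: "bounded_clinear A" and B: "bounded_clinear B" and comm: "\<And>x. A (B x) = B (A x)"
    and sa: "\<And>x y. rinner (A x) y = rinner x (A y)" "\<And>x y. rinner (B x) y = rinner x (B y)"
    and nontrivial: "(UNIV :: 'a set) \<noteq> {0}"
  defines "r \<equiv> geometric_spectral_radius A B"
  shows "0 \<le> r" "(norm (A x))\<^sup>2 + (norm (B x))\<^sup>2 \<le> r\<^sup>2 * (norm x)\<^sup>2"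
    "\<And>k. 0 \<le> k \<Longrightarrow> (\<And>x. (norm (A x))\<^sup>2 + (norm (B x))\<^sup>2 \<le> k\<^sup>2 * (norm x)\<^sup>2) \<Longrightarrow> r \<le> k"
proof -
  obtain a b where ev: "\<And>e. e > 0 \<Longrightarrow> \<exists>x. norm x = 1 \<and> norm (A x - a *\<^sub>R x) \<le> e \<and> norm (B x - b *\<^sub>R x) \<le> e"
    and le: "\<And>x. (norm (A x))\<^sup>2 + (norm (B x))\<^sup>2 \<le> (a\<^sup>2 + b\<^sup>2) * (norm x)\<^sup>2"
    by (rule joint_approx_eigenvector[OF bounded_clinear_imp(1)[OF A] bounded_clinear_imp(1)[OF B]
          comm sa nontrivial]) (rule that)
  have mem: "(complex_of_real a, complex_of_real b) \<in> taylor_spectrum A B"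
    by (rule approx_eigenvector_in_taylor_spectrum[OF sa ev])
  have r: "r = sqrt (a\<^sup>2 + b\<^sup>2)"
    unfolding r_def geometric_spectral_radius_def
  proof (rule Greatest_equality)
    show "sqrt (a\<^sup>2 + b\<^sup>2) \<in> {sqrt ((cmod z)\<^sup>2 + (cmod w)\<^sup>2) | z w. (z, w) \<in> taylor_spectrum A B}"
      using mem by (intro CollectI exI[of _ "complex_of_real a"] exI[of _ "complex_of_real b"]) simp
    fix s assume "s \<in> {sqrt ((cmod z)\<^sup>2 + (cmod w)\<^sup>2) | z w. (z, w) \<in> taylor_spectrum A B}"
    then show "s \<le> sqrt (a\<^sup>2 + b\<^sup>2)"
      using taylor_spectrum_bound[OF A B comm le] by auto
  qed
  show "0 \<le> r" by (simp add: r)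
  show "(norm (A x))\<^sup>2 + (norm (B x))\<^sup>2 \<le> r\<^sup>2 * (norm x)\<^sup>2" using le by (simp add: r)
  fix k :: real
  assume k: "0 \<le> k" "\<And>x. (norm (A x))\<^sup>2 + (norm (B x))\<^sup>2 \<le> k\<^sup>2 * (norm x)\<^sup>2"
  have "a\<^sup>2 + b\<^sup>2 \<le> k\<^sup>2" using taylor_spectrum_bound[OF A B comm k(2) _ mem] by simp
  then show "r \<le> k" unfolding r by (rule real_le_lsqrt[rotated -1]) (use k in simp_all)
qed

section \<open>The norm formula\<close>

lemma norm_abs_op:
  assumes "bounded_clinear T"
  shows "norm (abs_op T x) = norm (T x)"
proof -
  have "(norm (abs_op T x))\<^sup>2 = rinner x (abs_op T (abs_op T x))"
    unfolding rinner_self[symmetric] by (rule positive_op_selfadjoint(1)[OF abs_op(1)[OF assms]])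
  also have "\<dots> = (norm (T x))\<^sup>2"
    by (simp add: abs_op(2)[OF assms] rinner_self flip: rinner_cadjoint(1)[OF assms])
  finally show ?thesis by simp
qed

text \<open>The commutation clause of \<open>abs_op\<close> is used twice: E*E commutes with Q and
  Q*, hence with Q*Q and with |Q|; then |Q|, commuting with E*E, commutes with |E|.\<close>

lemma class_Q_abs_op_commute:
  assumes "class_Q T V E Q"
  shows "abs_op Q (abs_op E x) = abs_op E (abs_op Q x)"
proof -
  have E: "bounded_clinear E" and Q: "bounded_clinear Q"
    and QE: "\<And>x. Q (cadjoint E (E x)) = cadjoint E (E (Q x))"
    using assms by (auto simp: class_Q_def fun_eq_iff)
  have pE: "bounded_clinear (abs_op E)" and pQ: "bounded_clinear (abs_op Q)"
    using abs_op(1)[OF E] abs_op(1)[OF Q] by (auto simp: positive_op_def)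
  have EE: "bounded_clinear (\<lambda>x. cadjoint E (E x))" by (rule bounded_clinear_compose[OF cadjoint(1)[OF E] E])
  have sa: "rinner (cadjoint E (E x)) y = rinner x (cadjoint E (E y))" for x y
    unfolding rinner_cadjoint[OF E] by (rule refl)
  have "cadjoint Q (cadjoint E (E x)) = cadjoint E (E (cadjoint Q x))" for x
    by (rule cadjoint_adjoint_commute[OF Q sa QE])
  then have "cadjoint E (E (cadjoint Q (Q x))) = cadjoint Q (Q (cadjoint E (E x)))" for x
    by (simp add: QE)
  then have "cadjoint E (E (abs_op Q x)) = abs_op Q (cadjoint E (E x))" for x
    by (rule abs_op(3)[OF Q EE])
  then show ?thesis by (intro abs_op(3)[OF E pQ]) simp
qed

text \<open>Pythagoras: \<open>V\<close> is isometric, and V*E = 0 makes the ranges of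
  \<open>V\<close> and \<open>E\<close> orthogonal.\<close>

lemma class_Q_norm:
  assumes "class_Q T V E Q"
  shows "(norm (T (x, y)))\<^sup>2 = (norm x)\<^sup>2 + ((norm (abs_op Q y))\<^sup>2 + (norm (abs_op E y))\<^sup>2)"
proof -
  have V: "bounded_clinear V" and E: "bounded_clinear E" and Q: "bounded_clinear Q"
    and VV: "\<And>x. cadjoint V (V x) = x" and VE: "\<And>y. cadjoint V (E y) = 0"
    and T: "T (x, y) = (V x + E y, Q y)"
    using assms by (auto simp: class_Q_def block_op_def fun_eq_iff)
  have "(norm (V x))\<^sup>2 = (norm x)\<^sup>2" by (simp add: rinner_cadjoint(1)[OF V] VV flip: rinner_self)
  moreover have "rinner (V x) (E y) = 0" by (simp add: rinner_cadjoint(1)[OF V] VE)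
  ultimately show ?thesis
    by (simp add: T norm_prod_def norm_add_sq norm_abs_op[OF E] norm_abs_op[OF Q])
qed

theorem proposition3p4:
  fixes T :: "'a::complex_hilbert_space \<times> 'b::complex_hilbert_space \<Rightarrow> 'a \<times> 'b"
    and V :: "'a \<Rightarrow> 'a" and E :: "'b \<Rightarrow> 'a" and Q :: "'b \<Rightarrow> 'b"
  assumes "(UNIV :: 'a set) \<noteq> {0}" and "(UNIV :: 'b set) \<noteq> {0}"
    and "class_Q T V E Q"
  shows "onorm T = max 1 (geometric_spectral_radius (abs_op Q) (abs_op E))"
proof -
  note nT = class_Q_norm[OF assms(3)]
  have T: "bounded_linear T" and E: "bounded_clinear E" and Q: "bounded_clinear Q"
    using assms(3) by (auto simp: class_Q_def bounded_clinear_def)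
  note aE = abs_op(1)[OF E] and aQ = abs_op(1)[OF Q]
  define r where "r = geometric_spectral_radius (abs_op Q) (abs_op E)"
  note radius = geometric_spectral_radius_selfadjoint[OF aQ[unfolded positive_op_def, THEN conjunct1]
      aE[unfolded positive_op_def, THEN conjunct1] class_Q_abs_op_commute[OF assms(3)]
      positive_op_selfadjoint(1)[OF aQ] positive_op_selfadjoint(1)[OF aE] assms(2), folded r_def]
  have "onorm T \<le> max 1 r"
  proof (rule onorm_bound)
    fix p :: "'a \<times> 'b"
    obtain x y where p: "p = (x, y)" by fastforce
    have "1\<^sup>2 \<le> (max 1 r)\<^sup>2" "r\<^sup>2 \<le> (max 1 r)\<^sup>2" using radius(1) by (intro power_mono; simp)+
    then have "1 * (norm x)\<^sup>2 + r\<^sup>2 * (norm y)\<^sup>2 \<le> (max 1 r)\<^sup>2 * (norm x)\<^sup>2 + (max 1 r)\<^sup>2 * (norm y)\<^sup>2"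
      by (intro add_mono mult_right_mono) simp_all
    moreover have "(norm (x, y))\<^sup>2 = (norm x)\<^sup>2 + (norm y)\<^sup>2" by (simp add: norm_prod_def)
    ultimately have "(norm (T p))\<^sup>2 \<le> (max 1 r * norm p)\<^sup>2"
      unfolding p nT power_mult_distrib using radius(2)[of y] by (simp add: distrib_left)
    then show "norm (T p) \<le> max 1 r * norm p" by (rule power2_le_imp_le) simp
  qed simp
  moreover have "1 \<le> onorm T"
  proof -
    \<comment> \<open>\<open>T\<close> is isometric on the first summand, which contains a nonzero
      vector.\<close>
    obtain x :: 'a where x: "x \<noteq> 0" using assms(1) by blast
    have "(norm (T (x, 0)))\<^sup>2 = (norm x)\<^sup>2"
      by (simp add: nT norm_abs_op[OF E] norm_abs_op[OF Q] bounded_clinear_imp(6)[OF E] bounded_clinear_imp(6)[OF Q])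
    then have "norm x \<le> onorm T * norm x" using onorm[OF T, of "(x, 0)"] by (simp add: norm_Pair)
    then show ?thesis using x by simp
  qed
  moreover have "r \<le> onorm T"
  \<comment> \<open>Restricted to the second summand, \<open>T\<close> has the norm of the column of
    |Q| and |E|, so \<open>onorm T\<close> is an admissible constant and \<open>r\<close> is the
    least one.\<close>
  proof (rule radius(3)[OF onorm_pos_le[OF T]])
    fix y
    have "(norm (T (0, y)))\<^sup>2 \<le> (onorm T * norm (0::'a, y))\<^sup>2"
      by (intro power_mono onorm[OF T]) simp
    then show "(norm (abs_op Q y))\<^sup>2 + (norm (abs_op E y))\<^sup>2 \<le> (onorm T)\<^sup>2 * (norm y)\<^sup>2"
      by (simp add: nT norm_Pair power_mult_distrib)
  qed
  ultimately show ?thesis unfolding r_def[symmetric] by simp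
qed

end
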